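(* Let $X\subset H(\mathbb{D})$ be a Banach space of analytic functions on the unit disk $\mathbb{D}$ that contains $H^\infty$, and let $X_{\mathcal{P}}$ be the closure of the polynomials in $X$. Then for every one-parameter semigroup $\{\phi_t\}_{t\ge0}$ of analytic self-maps of $\mathbb{D}$ that acts on $X$, $X_{\mathcal{P}}\subset[\phi_t,X]$.
   Context: $\mathbb{D}=\{z\in\mathbb{C}:|z|<1\}$, $H(\mathbb{D})$ is the set of analytic functions on $\mathbb{D}$, and $H^\infty$ is the space of bounded functions in $H(\mathbb{D})$ with the supremum norm. A one-parameter semigroup $\{\phi_t\}_{t\ge0}$ of analytic functions on $\mathbb{D}$ is a family of analytic functions $\phi_t:\mathbb{D}\to\mathbb{D}$ such that: $\phi_0(z)=z$ for $z\in\mathbb{D}$; $\phi_{s+t}=\phi_s\circ\phi_t$ for all $s,t\ge0$; and $(t,z)\mapsto\phi_t(z)$ is continuous on $[0,\infty)\times\mathbb{D}$. Put $C_t(f)=f\circ\phi_t$ for $f\in H(\mathbb{D})$. A Banach space of analytic functions on $\mathbb{D}$ is a linear subspace $X\subset H(\mathbb{D})$ with a complete norm $\|\cdot\|_X$ for which point evaluations at points of $\mathbb{D}$ are continuous. The semigroup $\{\phi_t\}$ acts on $X$ if $C_t$ is a bounded operator on $X$ for every $t\ge0$. In that case $[\phi_t,X]$ denotes the maximal (i.e. largest) closed subspace of $X$ on which $\{C_t\}$ is strongly continuous, i.e. on which $\lim_{t\to0^+}\|f\circ\phi_t-f\|_X=0$ for every element $f$; as in the definition of $[\phi_t,X]$,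 it is understood that this largest subspace exists. *)

theory Defs
  imports "HOL-Analysis.Analysis" "HOL-Library.Function_Algebras"
    "HOL-Computational_Algebra.Polynomial"
begin

abbreviation unit_disk :: "complex set" where
  "unit_disk \<equiv> ball 0 1"

text \<open>A function on the disk is represented by its extension by zero to the whole plane. Equality
  in HOL is then equality on the disk, and the pointwise operations on functions are the vector
  space operations on functions on the disk.\<close>

definition disk_fun :: "(complex \<Rightarrow> complex) \<Rightarrow> complex \<Rightarrow> complex" where
  "disk_fun f = (\<lambda>z. if z \<in> unit_disk then f z else 0)"

definition H_disk :: "(complex \<Rightarrow> complex) set" where
  "H_disk = {f. f holomorphic_on unit_disk \<and> (\<forall>z. z \<notin> unit_disk \<longrightarrow> f z = 0)}"

definition H_infty :: "(complex \<Rightarrow> complex) set" where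
  "H_infty = {f \<in> H_disk. bounded (f ` unit_disk)}"

definition polynomials_disk :: "(complex \<Rightarrow> complex) set" where
  "polynomials_disk = range (\<lambda>p :: complex poly. disk_fun (poly p))"

definition fscale :: "complex \<Rightarrow> (complex \<Rightarrow> complex) \<Rightarrow> complex \<Rightarrow> complex" where
  "fscale c f = (\<lambda>z. c * f z)"

global_interpretation fun_space: vector_space fscale
  by unfold_locales (auto simp: fscale_def fun_eq_iff algebra_simps)

definition norm_dist ::
    "(complex \<Rightarrow> complex) set \<Rightarrow> ((complex \<Rightarrow> complex) \<Rightarrow> real) \<Rightarrow>
     (complex \<Rightarrow> complex) \<Rightarrow> (complex \<Rightarrow> complex) \<Rightarrow> real" where
  "norm_dist X N f g = (if f \<in> X \<and> g \<in> X then N (f - g) else 0)"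

text \<open>The norm \<open>N\<close> is constrained on \<open>X\<close> only. Since \<^locale>\<open>Metric_space\<close> requires a distance that
  is nonnegative and symmetric off the carrier as well, \<^const>\<open>norm_dist\<close> is set to zero there.\<close>

locale normed_analytic_space =
  fixes X :: "(complex \<Rightarrow> complex) set" and N :: "(complex \<Rightarrow> complex) \<Rightarrow> real"
  assumes analytic: "X \<subseteq> H_disk"
    and subspace: "fun_space.subspace X"
    and norm_nonneg: "f \<in> X \<Longrightarrow> 0 \<le> N f"
    and norm_eq_0: "f \<in> X \<Longrightarrow> N f = 0 \<longleftrightarrow> f = 0"
    and norm_scale: "f \<in> X \<Longrightarrow> N (fscale c f) = cmod c * N f"
    and norm_triangle: "f \<in> X \<Longrightarrow> g \<in> X \<Longrightarrow> N (f + g) \<le> N f + N g"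

sublocale normed_analytic_space \<subseteq> Metric_space X "norm_dist X N"
proof
  have diff: "f - g \<in> X" if "f \<in> X" "g \<in> X" for f g
    using that subspace by (rule fun_space.subspace_diff[rotated])
  show "0 \<le> norm_dist X N f g" for f g
    by (simp add: norm_dist_def diff norm_nonneg)
  show "norm_dist X N f g = norm_dist X N g f" for f g
  proof (cases "f \<in> X \<and> g \<in> X")
    case True
    have "fscale (-1) (g - f) = f - g"
      by (simp add: fscale_def fun_eq_iff)
    with True norm_scale[of "g - f" "-1"] show ?thesis
      by (simp add: norm_dist_def diff)
  qed (auto simp: norm_dist_def)
  show "norm_dist X N f g = 0 \<longleftrightarrow> f = g" if "f \<in> X" "g \<in> X" for f g
    using that by (simp add: norm_dist_def norm_eq_0 diff)
  show "norm_dist X N f h \<le> norm_dist X N f g + norm_dist X N g h"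
    if "f \<in> X" "g \<in> X" "h \<in> X" for f g h
    using that norm_triangle[of "f - g" "g - h"] by (simp add: norm_dist_def diff)
qed

locale banach_analytic_space = normed_analytic_space +
  assumes complete: "mcomplete"
    and eval_continuous: "z \<in> unit_disk \<Longrightarrow> continuous_map mtopology euclidean (\<lambda>f. f z)"

definition norm_topology ::
    "(complex \<Rightarrow> complex) set \<Rightarrow> ((complex \<Rightarrow> complex) \<Rightarrow> real) \<Rightarrow> (complex \<Rightarrow> complex) topology" where
  "norm_topology X N = Metric_space.mtopology X (norm_dist X N)"

text \<open>The intersection with \<open>X\<close> that is built into the library's closure is harmless in the
  presence of \<^term>\<open>H_infty \<subseteq> X\<close>, which puts every polynomial into \<open>X\<close>.\<close>

definition poly_closure ::
    "(complex \<Rightarrow> complex) set \<Rightarrow> ((complex \<Rightarrow> complex) \<Rightarrow> real) \<Rightarrow> (complex \<Rightarrow> complex) set" where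
  "poly_closure X N = norm_topology X N closure_of polynomials_disk"

text \<open>Only the values \<open>\<phi> t z\<close> with \<open>t \<ge> 0\<close> and \<open>z\<close> in the disk matter.\<close>

definition analytic_semigroup :: "(real \<Rightarrow> complex \<Rightarrow> complex) \<Rightarrow> bool" where
  "analytic_semigroup \<phi> \<longleftrightarrow>
     (\<forall>t\<ge>0. \<phi> t holomorphic_on unit_disk \<and> \<phi> t ` unit_disk \<subseteq> unit_disk) \<and>
     (\<forall>z\<in>unit_disk. \<phi> 0 z = z) \<and>
     (\<forall>s\<ge>0. \<forall>t\<ge>0. \<forall>z\<in>unit_disk. \<phi> (s + t) z = \<phi> s (\<phi> t z)) \<and>
     continuous_on ({0..} \<times> unit_disk) (\<lambda>(t, z). \<phi> t z)"

definition comp_op ::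
    "(real \<Rightarrow> complex \<Rightarrow> complex) \<Rightarrow> real \<Rightarrow> (complex \<Rightarrow> complex) \<Rightarrow> complex \<Rightarrow> complex" where
  "comp_op \<phi> t f = disk_fun (f \<circ> \<phi> t)"

definition acts_on ::
    "(real \<Rightarrow> complex \<Rightarrow> complex) \<Rightarrow> (complex \<Rightarrow> complex) set \<Rightarrow> ((complex \<Rightarrow> complex) \<Rightarrow> real) \<Rightarrow> bool" where
  "acts_on \<phi> X N \<longleftrightarrow>
     (\<forall>t\<ge>0. (\<forall>f\<in>X. comp_op \<phi> t f \<in> X) \<and> (\<exists>K. \<forall>f\<in>X. N (comp_op \<phi> t f) \<le> K * N f))"

definition strongly_continuous_subspace ::
    "(real \<Rightarrow> complex \<Rightarrow> complex) \<Rightarrow> (complex \<Rightarrow> complex) set \<Rightarrow> ((complex \<Rightarrow> complex) \<Rightarrow> real) \<Rightarrow>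
     (complex \<Rightarrow> complex) set \<Rightarrow> bool" where
  "strongly_continuous_subspace \<phi> X N Y \<longleftrightarrow>
     Y \<subseteq> X \<and> fun_space.subspace Y \<and> closedin (norm_topology X N) Y \<and>
     (\<forall>f\<in>Y. ((\<lambda>t. N (comp_op \<phi> t f - f)) \<longlongrightarrow> 0) (at_right 0))"

text \<open>The set of all \<open>f\<close> with \<open>N (comp_op \<phi> t f - f) \<rightarrow> 0\<close> is linear, but it is not obviously closed
  unless the norms of the composition operators are bounded as \<open>t \<rightarrow> 0\<close>. The existence of the largest
  subspace is therefore a separate predicate; \<open>max_subspace \<phi> X N\<close>, which stands for \<open>[\<phi>\<^sub>t, X]\<close>, is
  meaningful only under it.\<close>

definition has_max_subspace ::
    "(real \<Rightarrow> complex \<Rightarrow> complex) \<Rightarrow> (complex \<Rightarrow> complex) set \<Rightarrow> ((complex \<Rightarrow> complex) \<Rightarrow> real) \<Rightarrow> bool" where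
  "has_max_subspace \<phi> X N \<longleftrightarrow>
     (\<exists>Y. strongly_continuous_subspace \<phi> X N Y \<and>
          (\<forall>Z. strongly_continuous_subspace \<phi> X N Z \<longrightarrow> Z \<subseteq> Y))"

definition max_subspace ::
    "(real \<Rightarrow> complex \<Rightarrow> complex) \<Rightarrow> (complex \<Rightarrow> complex) set \<Rightarrow> ((complex \<Rightarrow> complex) \<Rightarrow> real) \<Rightarrow>
     (complex \<Rightarrow> complex) set" where
  "max_subspace \<phi> X N = (GREATEST Y. strongly_continuous_subspace \<phi> X N Y)"

end

theory Submission
  imports Defs "HOL-Complex_Analysis.Complex_Analysis"
begin

text \<open>On \<^const>\<open>H_infty\<close> the norm of \<open>X\<close> is dominated by the supremum norm (closed graph theorem), so it
  is enough that \<open>\<phi> t\<close> tends to the identity uniformly on the whole disk: then every polynomial spans a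
  closed line on which the semigroup is strongly continuous, the largest such subspace contains this
  line, and it is closed.

  Suppose the convergence is not uniform. As it is locally uniform, there are trajectories, run
  through in arbitrarily short time \<open>t\<close>, that stay close to the unit circle and sweep a fixed angle
  around \<open>0\<close>. The function \<open>f z = \<integral>\<^sub>0\<^sup>a \<phi> s z ds\<close> is bounded, satisfies \<open>|f (\<phi> t z) - f z| \<le> 2 t\<close> on the
  disk and has \<open>f' 0 \<noteq> 0\<close> for small \<open>a\<close>, so it is almost constant along those arcs. This contradicts
  Koebe's lemma that a bounded holomorphic function that is small on such arcs is small at \<open>0\<close>.\<close>

subsection \<open>Koebe's lemma\<close>

text \<open>The component of the complement of the curve that contains \<open>z\<close> has a
  constant non-zero winding number, so it stays inside the convex hull of the curve and hence in
  \<open>S\<close>. Its frontier lies on the curve, and the maximum modulus principle applies to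
  it.\<close>

lemma maximum_modulus_winding:
  assumes f: "f holomorphic_on S" and S: "open S" "convex S"
    and \<gamma>: "path \<gamma>" "pathfinish \<gamma> = pathstart \<gamma>" "path_image \<gamma> \<subseteq> S"
    and z: "z \<notin> path_image \<gamma>" "winding_number \<gamma> z \<noteq> 0"
    and bound: "\<And>w. w \<in> path_image \<gamma> \<Longrightarrow> norm (f w) \<le> K"
  shows "norm (f z) \<le> K"
proof -
  define U where "U = connected_component_set (- path_image \<gamma>) z"
  let ?H = "convex hull (path_image \<gamma>)"
  have H: "compact ?H" "?H \<subseteq> S"
    using \<gamma> S by (auto simp: compact_convex_hull compact_path_image subset_hull)
  have "z \<in> U"
    using z by (simp add: U_def)
  have U_sub: "U \<subseteq> ?H"
  proof
    fix w assume "w \<in> U"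
    have "U \<inter> path_image \<gamma> = {}"
      using connected_component_subset[of "- path_image \<gamma>" z] by (auto simp: U_def)
    then have "winding_number \<gamma> w = winding_number \<gamma> z"
      using \<gamma> \<open>w \<in> U\<close> \<open>z \<in> U\<close> by (intro winding_number_eq[of _ _ U]) (auto simp: U_def)
    then show "w \<in> ?H"
      using winding_number_zero_outside[of \<gamma> ?H w] \<gamma> z hull_subset[of "path_image \<gamma>" convex] by auto
  qed
  have cl: "closure U \<subseteq> S"
    using closure_minimal[OF U_sub] H compact_imp_closed by blast
  have "frontier U \<subseteq> path_image \<gamma>"
    using frontier_of_connected_component_subset[of "- path_image \<gamma>" z]
      frontier_subset_closed[OF closed_path_image[OF \<gamma>(1)]] by (auto simp: U_def)
  moreover have "f holomorphic_on interior U" "f holomorphic_on closure U"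
    using cl interior_subset[of U] closure_subset[of U] by (auto intro!: holomorphic_on_subset[OF f])
  ultimately show ?thesis
    using \<open>z \<in> U\<close> U_sub H bound
    by (intro maximum_modulus_frontier[of f U K z] holomorphic_on_imp_continuous_on)
       (auto intro: bounded_subset compact_imp_bounded)
qed

text \<open>Since \<open>p\<close> ends on the real axis, it can be continued by its reversed mirror
  image. The result runs from \<open>pathstart p\<close> to its conjugate, which is the translate by
  \<open>2 * of_real \<theta> * \<i>\<close>, so translated copies of it fit together end to
  end.\<close>

lemma path_of_reflections:
  assumes p: "path p" "path_image p \<subseteq> S" "Im (pathfinish p) = 0" "Im (pathstart p) = - \<theta>"
    and cnj: "\<And>z. z \<in> S \<Longrightarrow> cnj z \<in> S"
    and shift: "\<And>z. z \<in> S \<Longrightarrow> z + 2 * of_real \<theta> * \<i> \<in> S"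
  shows "\<exists>q. path q \<and> path_image q \<subseteq> S \<and> pathstart q = pathstart p \<and>
    pathfinish q = pathstart p + of_nat k * (2 * of_real \<theta> * \<i>)"
proof (induction k)
  case 0
  have "pathstart p \<in> S"
    using p by auto
  then show ?case
    by (intro exI[of _ "linepath (pathstart p) (pathstart p)"]) (auto simp: path_def pathstart_def pathfinish_def path_image_def)
next
  case (Suc k)
  let ?s = "of_nat k * (2 * of_real \<theta> * \<i>)"
  have shiftk: "z + of_nat k * (2 * of_real \<theta> * \<i>) \<in> S" if "z \<in> S" for z
    using that
  proof (induction k)
    case (Suc k)
    from shift[OF Suc.IH[OF Suc.prems]] show ?case
      by (simp add: algebra_simps)
  qed simp
  from Suc obtain q where q: "path q" "path_image q \<subseteq> S" "pathstart q = pathstart p"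
    "pathfinish q = pathstart p + ?s"
    by blast
  define r where "r = p +++ (cnj \<circ> reversepath p)"
  have fin: "cnj (pathfinish p) = pathfinish p"
    using p by (simp add: complex_eq_iff)
  have r: "path r" "pathstart r = pathstart p" "pathfinish r = cnj (pathstart p)" "path_image r \<subseteq> S"
    unfolding r_def using p fin cnj
    by (auto simp: pathstart_compose pathfinish_compose path_image_compose path_image_join
      intro!: path_join_imp path_continuous_image continuous_intros)
  have r': "cnj (pathstart p) = pathstart p + 2 * of_real \<theta> * \<i>"
    using p by (simp add: complex_eq_iff)
  let ?t = "\<lambda>z. z + ?s"
  have "path (q +++ (?t \<circ> r))"
    using q r by (intro path_join_imp path_continuous_image continuous_intros) (auto simp: pathstart_compose)
  moreover have "path_image (q +++ (?t \<circ> r)) \<subseteq> S"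
    using q r shiftk by (intro subset_path_image_join) (auto simp: path_image_compose)
  moreover have "pathfinish (q +++ (?t \<circ> r)) = pathstart p + of_nat (Suc k) * (2 * of_real \<theta> * \<i>)"
    using r r' by (simp add: pathfinish_compose algebra_simps)
  ultimately show ?case
    using q by (intro exI[of _ "q +++ (?t \<circ> r)"]) simp
qed

text \<open>The product of \<open>g\<close> over all rotations by multiples of \<open>2 \<pi> / (M + 1)\<close>, times its reflection in
  the real axis, is small on the arc \<open>exp \<circ> p\<close> and on the closed curve assembled from the rotated
  copies of the arc and of its mirror image. This curve winds once around \<open>0\<close>.\<close>

lemma koebe_arc_bound_aux:
  assumes g: "g holomorphic_on ball 0 1" and gB: "\<And>z. z \<in> ball 0 1 \<Longrightarrow> norm (g z) \<le> B"
    and p: "path p" "exp ` path_image p \<subseteq> ball 0 1"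
      "Im (pathfinish p) = 0" "Im (pathstart p) = - (pi / of_nat (Suc M))"
    and bound: "\<And>z. z \<in> path_image p \<Longrightarrow> norm (g (exp z)) \<le> \<eta>"
  shows "norm (g 0) ^ (2 * Suc M) \<le> B ^ (2 * M + 1) * \<eta>"
proof -
  define N where "N = Suc M"
  define \<omega> where "\<omega> = cis (2 * pi / of_nat N)"
  define F where "F = (\<lambda>z. \<Prod>k<N. g (\<omega> ^ k * z))"
  define G where "G = (\<lambda>z. F z * cnj (F (cnj z)))"
  \<comment> \<open>On the arc, the factor of \<open>F\<close> with \<open>k = 0\<close> is at most
    \<eta>; the remaining \<open>2 * M + 1\<close> of the \<open>2 * N\<close> factors of
    \<open>G\<close> are at most \<open>B\<close>.\<close>
  define K where "K = B ^ (2 * M + 1) * \<eta>"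
  define \<theta> where "\<theta> = pi / of_nat N"
  have norm_\<omega> [simp]: "norm (\<omega> ^ k * z) = norm z" for k z
    by (simp add: \<omega>_def norm_mult norm_power)
  have \<omega>N: "\<omega> ^ N = 1"
    unfolding \<omega>_def Complex.DeMoivre by (simp add: N_def del: of_nat_Suc)
  have "norm (g 0) \<ge> 0" "norm (g 0) \<le> B"
    using gB[of 0] by auto
  then have B: "B \<ge> 0"
    by linarith
  have \<eta>: "\<eta> \<ge> 0"
    using bound[of "pathstart p"] norm_ge_zero[of "g (exp (pathstart p))"]
    by (meson order_trans pathstart_in_path_image)
  have F_rot: "F (\<omega> * z) = F z" for z
  proof -
    have "F (\<omega> * z) = (\<Prod>k<Suc M. g (\<omega> ^ Suc k * z))"
      by (simp add: F_def N_def mult.assoc mult.left_commute)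
    also have "\<dots> = (\<Prod>k<M. g (\<omega> ^ Suc k * z)) * g z"
      using \<omega>N by (simp add: N_def)
    also have "\<dots> = F z"
      unfolding F_def N_def prod.lessThan_Suc_shift by (simp add: mult.commute)
    finally show ?thesis .
  qed
  \<comment> \<open>A rotation of \<open>z\<close> by \<omega> reaches the reflected factor of
    \<open>G\<close> as the inverse rotation, so both invariances are needed for that of
    \<open>G\<close>.\<close>
  have F_rot': "F (cnj \<omega> * z) = F z" for z
  proof -
    have "\<omega> * cnj \<omega> = 1"
      by (simp add: \<omega>_def cis_cnj cis_mult)
    then show ?thesis
      using F_rot[of "cnj \<omega> * z"] by (simp flip: mult.assoc)
  qed
  have F_hol: "F holomorphic_on ball 0 1"
    unfolding F_def
  proof (rule holomorphic_on_prod)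
    fix k
    have "g \<circ> (\<lambda>z. \<omega> ^ k * z) holomorphic_on ball 0 1"
      by (rule holomorphic_on_compose_gen[OF _ g]) (auto intro!: holomorphic_intros)
    then show "(\<lambda>z. g (\<omega> ^ k * z)) holomorphic_on ball 0 1"
      by (simp add: o_def)
  qed
  have "cnj \<circ> F \<circ> cnj holomorphic_on ball 0 1"
  proof (rule holomorphic_on_compose_cnj_cnj)
    show "F holomorphic_on cnj ` ball 0 1"
      by (rule holomorphic_on_subset[OF F_hol]) auto
  qed auto
  then have G_hol: "G holomorphic_on ball 0 1"
    unfolding G_def using F_hol by (auto simp: o_def intro!: holomorphic_intros)
  have F_bound: "norm (F z) \<le> B ^ N" if "norm z < 1" for z
  proof -
    have "norm (F z) \<le> (\<Prod>k<N. B)"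
      unfolding F_def prod_norm[symmetric] using that gB by (intro prod_mono) auto
    then show ?thesis
      by simp
  qed
  have F_bound': "norm (F z) \<le> B ^ M * \<eta>" if "norm z < 1" "norm (g z) \<le> \<eta>" for z
  proof -
    have "norm (F z) = norm (g z) * (\<Prod>k<M. norm (g (\<omega> ^ Suc k * z)))"
      unfolding F_def N_def prod.lessThan_Suc_shift prod_norm[symmetric] by (simp add: norm_mult prod_norm)
    also have "\<dots> \<le> \<eta> * (\<Prod>k<M. B)"
      using that gB \<eta> norm_\<omega>[of "Suc _" z] by (intro mult_mono prod_mono prod_nonneg) (auto simp del: power_Suc)
    finally show ?thesis
      by (simp add: mult.commute)
  qed
  \<comment> \<open>Pulled back through \<open>exp\<close>, rotations by \<omega> become
    translations by \<open>2 * of_real \<theta> * \<i>\<close>, and the assembled curve can be built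
    as a path of logarithms. \<open>S\<close> inherits the symmetries of
    \<open>norm \<circ> G\<close>.\<close>
  define S where "S = {z. exp z \<in> ball 0 1 \<and> norm (G (exp z)) \<le> K}"
  have "norm (G (exp z)) \<le> K" if "z \<in> path_image p" for z
  proof -
    have "norm (exp z) < 1" "norm (g (exp z)) \<le> \<eta>"
      using p bound that by force+
    then have "norm (G (exp z)) \<le> (B ^ M * \<eta>) * B ^ N"
      unfolding G_def norm_mult using B \<eta>
      by (intro mult_mono) (auto intro!: F_bound F_bound')
    then show ?thesis
      by (simp add: K_def N_def power_add mult_2 mult_2_right ac_simps)
  qed
  then have pS: "path_image p \<subseteq> S"
    using p by (auto simp: S_def)
  have "\<exists>q. path q \<and> path_image q \<subseteq> S \<and> pathstart q = pathstart p \<and>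
    pathfinish q = pathstart p + of_nat N * (2 * of_real \<theta> * \<i>)"
  proof (rule path_of_reflections[OF p(1) pS p(3)])
    show "Im (pathstart p) = - \<theta>"
      using p by (simp add: \<theta>_def N_def)
    show "cnj z \<in> S" if "z \<in> S" for z
      using that by (simp add: S_def G_def norm_mult exp_cnj mult.commute flip: exp_cnj)
    show "z + 2 * of_real \<theta> * \<i> \<in> S" if "z \<in> S" for z
    proof -
      have "exp (2 * of_real \<theta> * \<i>) = \<omega>"
        by (simp add: \<omega>_def \<theta>_def cis_conv_exp mult.commute)
      then have e: "exp (z + 2 * of_real \<theta> * \<i>) = \<omega> * exp z"
        by (simp add: exp_add)
      show ?thesis
        using that norm_\<omega>[of 1 "exp z"] unfolding S_def mem_Collect_eq e G_def by (simp add: F_rot F_rot')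
    qed
  qed
  then obtain q where q: "path q" "path_image q \<subseteq> S" "pathfinish q = pathstart q + of_nat N * (2 * of_real \<theta> * \<i>)"
    by auto
  \<comment> \<open>The \<open>N\<close> translations add up to a full turn, so
    \<open>exp \<circ> q\<close> closes up and winds once around 0.\<close>
  have N\<theta>: "of_nat N * (2 * of_real \<theta> * \<i>) = 2 * of_real pi * \<i>"
    by (simp add: \<theta>_def N_def del: of_nat_Suc)
  have "norm (G 0) \<le> K"
  proof (rule maximum_modulus_winding[OF G_hol open_ball convex_ball])
    show "path (exp \<circ> q)"
      using q by (intro path_continuous_image continuous_intros)
    show "pathfinish (exp \<circ> q) = pathstart (exp \<circ> q)"
      using q N\<theta> by (simp add: pathstart_compose pathfinish_compose exp_add)
    show "norm (G w) \<le> K" if "w \<in> path_image (exp \<circ> q)" for w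
      using q that by (auto simp: path_image_compose S_def)
    show "path_image (exp \<circ> q) \<subseteq> ball 0 1"
      using q by (auto simp: path_image_compose S_def)
    show "0 \<notin> path_image (exp \<circ> q)"
      by (auto simp: path_image_compose)
    show "winding_number (exp \<circ> q) 0 \<noteq> 0"
      using q N\<theta> by (simp add: winding_number_compose_exp)
  qed
  moreover have "norm (G 0) = norm (g 0) ^ (2 * N)"
    by (simp add: G_def F_def norm_mult norm_power power_add mult_2)
  ultimately show ?thesis
    by (simp add: N_def K_def)
qed

text \<open>A rotation about 0 brings the end of the arc to the positive real axis, as
  \<open>koebe_arc_bound_aux\<close> requires; it changes neither \<open>g 0\<close> nor the
  bounds.\<close>

lemma koebe_arc_bound:
  assumes g: "g holomorphic_on ball 0 1" and gB: "\<And>z. z \<in> ball 0 1 \<Longrightarrow> norm (g z) \<le> B"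
    and p: "path p" "exp ` path_image p \<subseteq> ball 0 1"
      "Im (pathfinish p) = Im (pathstart p) + pi / of_nat (Suc M)"
    and bound: "\<And>z. z \<in> path_image p \<Longrightarrow> norm (g (exp z)) \<le> \<eta>"
  shows "norm (g 0) ^ (2 * Suc M) \<le> B ^ (2 * M + 1) * \<eta>"
proof -
  define \<beta> where "\<beta> = Im (pathfinish p)"
  let ?r = "\<lambda>z. z - of_real \<beta> * \<i>"
  let ?g = "\<lambda>z. g (cis \<beta> * z)"
  have ex: "cis \<beta> * exp (?r z) = exp z" for z
    by (simp add: cis_conv_exp mult.commute flip: exp_add)
  have n: "norm (exp (?r z)) = norm (exp z)" for z
    by simp
  have "norm (?g 0) ^ (2 * Suc M) \<le> B ^ (2 * M + 1) * \<eta>"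
  proof (rule koebe_arc_bound_aux[of ?g B "?r \<circ> p"])
    have "g \<circ> (\<lambda>z. cis \<beta> * z) holomorphic_on ball 0 1"
      by (rule holomorphic_on_compose_gen[OF _ g]) (auto simp: norm_mult intro!: holomorphic_intros)
    then show "?g holomorphic_on ball 0 1"
      by (simp add: o_def)
    show "norm (?g z) \<le> B" if "z \<in> ball 0 1" for z
      using that by (intro gB) (simp add: norm_mult)
    show "path (?r \<circ> p)"
      using p by (intro path_continuous_image continuous_intros)
    show "exp ` path_image (?r \<circ> p) \<subseteq> ball 0 1"
      using p n by (auto simp: path_image_compose)
    show "Im (pathfinish (?r \<circ> p)) = 0" "Im (pathstart (?r \<circ> p)) = - (pi / of_nat (Suc M))"
      using p by (simp_all add: pathfinish_compose pathstart_compose \<beta>_def)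
    show "norm (?g (exp z)) \<le> \<eta>" if "z \<in> path_image (?r \<circ> p)" for z
      using that ex bound by (auto simp: path_image_compose)
  qed
  then show ?thesis
    by simp
qed

text \<open>Koebe's bound is applied first to \<open>f - c\<close> and then to the difference quotient \<open>(f z - f 0) / z\<close>.\<close>

lemma koebe_arc_deriv_bound:
  assumes f: "f holomorphic_on ball 0 1" and fB: "\<And>z. z \<in> ball 0 1 \<Longrightarrow> norm (f z) \<le> B"
    and p: "path p" "exp ` path_image p \<subseteq> ball 0 1 - ball 0 (1/2)"
      "Im (pathfinish p) = Im (pathstart p) + pi / of_nat (Suc M)"
    and bound: "\<And>z. z \<in> path_image p \<Longrightarrow> norm (f (exp z) - c) \<le> \<eta>" and c: "norm c \<le> B"
  shows "norm (deriv f 0) ^ (2 * Suc M)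
    \<le> (4 * B) ^ (2 * M + 1) * (2 * (\<eta> + root (2 * Suc M) ((2 * B) ^ (2 * M + 1) * \<eta>)))"
proof -
  let ?R = "root (2 * Suc M) ((2 * B) ^ (2 * M + 1) * \<eta>)"
  have le: "norm (f z - w) \<le> 2 * B" if "norm w \<le> B" "z \<in> ball 0 1" for z w
    using fB[OF that(2)] that(1) norm_triangle_ineq4[of "f z" w] by linarith
  have "norm (f 0 - c) ^ (2 * Suc M) \<le> (2 * B) ^ (2 * M + 1) * \<eta>"
    using p f le[OF c] bound by (intro koebe_arc_bound[of "\<lambda>z. f z - c" _ p]) (auto intro!: holomorphic_intros)
  then have "root (2 * Suc M) (norm (f 0 - c) ^ (2 * Suc M)) \<le> ?R"
    by (subst real_root_le_iff) auto
  then have f0: "norm (f 0 - c) \<le> ?R"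
    by (subst (asm) real_root_power_cancel) auto
  \<comment> \<open>The singularity at 0 is removable, and the value there is the derivative that
    the second application is meant to bound.\<close>
  define g where "g = (\<lambda>z. if z = 0 then deriv f 0 else (f z - f 0) / (z - 0))"
  have g_hol: "g holomorphic_on ball 0 1"
    unfolding g_def by (rule pole_lemma_open[OF f open_ball])
  have g_out: "norm (g z) \<le> 2 * a" if "norm z \<ge> 1/2" "norm (f z - f 0) \<le> a" for z a
  proof -
    have "norm (g z) = norm (f z - f 0) / norm z"
      using that by (auto simp: g_def norm_divide)
    also have "\<dots> \<le> a / (1/2)"
      using that by (intro frac_le) (auto intro: order_trans[OF norm_ge_zero])
    finally show ?thesis
      by simp
  qed
  have f0B: "norm (f 0) \<le> B"
    by (simp add: fB)
  have g_out_B: "norm (g z) \<le> 4 * B" if "norm z \<ge> 1/2" "norm z < 1" for z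
    using g_out[of z "2 * B"] le[OF f0B, of z] that by simp
  \<comment> \<open>Close to 0 the division gives no useful bound, so the one on the circle of
    radius \<open>1/2\<close> is carried inwards by the maximum modulus principle.\<close>
  have g_B: "norm (g z) \<le> 4 * B" if "z \<in> ball 0 1" for z
  proof (cases "norm z \<ge> 1/2")
    case False
    show ?thesis
    proof (rule maximum_modulus_frontier[of g "cball 0 (1/2)"])
      show "g holomorphic_on interior (cball 0 (1/2))" "continuous_on (closure (cball 0 (1/2))) g"
        using g_hol by (auto intro: holomorphic_on_subset holomorphic_on_imp_continuous_on[OF holomorphic_on_subset])
      show "norm (g w) \<le> 4 * B" if "w \<in> frontier (cball 0 (1/2))" for w
        using that by (intro g_out_B) auto
    qed (use False in auto)
  qed (use that g_out_B in auto)
  have "norm (g (exp z)) \<le> 2 * (\<eta> + ?R)" if "z \<in> path_image p" for z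
  proof (rule g_out)
    show "norm (exp z) \<ge> 1/2"
      using p that by (force simp: image_subset_iff)
    show "norm (f (exp z) - f 0) \<le> \<eta> + ?R"
      using norm_triangle_ineq4[of "f (exp z) - c" "f 0 - c"] f0 bound[OF that] by simp
  qed
  then have "norm (g 0) ^ (2 * Suc M) \<le> (4 * B) ^ (2 * M + 1) * (2 * (\<eta> + ?R))"
    using p g_hol g_B by (intro koebe_arc_bound[of g _ p]) auto
  then show ?thesis
    by (simp add: g_def)
qed

section \<open>Logarithms of curves near the unit circle\<close>

text \<open>The derivative of \<open>exp\<close> has modulus at most 1 on the closed left
  half-plane, which is convex.\<close>

lemma norm_exp_diff_le:
  assumes "Re a \<le> 0" "Re b \<le> 0"
  shows "norm (exp a - exp b) \<le> norm (a - b)"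
proof -
  have "norm (exp a - exp b) \<le> 1 * norm (a - b)"
  proof (rule field_differentiable_bound[of "{z. Re z \<le> 0}"])
    show "convex {z. Re z \<le> 0}"
      by (rule convex_halfspace_Re_le)
    show "(exp has_field_derivative exp z) (at z within {z. Re z \<le> 0})" for z
      by (rule DERIV_subset[OF DERIV_exp]) auto
  qed (use assms in auto)
  then show ?thesis
    by simp
qed

text \<open>In a thin annulus the real part of the logarithm hardly varies, so a displacement by
  \<epsilon> must come from the argument. The intermediate value theorem then cuts off a piece whose
  end points differ in argument by exactly \<open>h\<close>.\<close>

lemma exists_log_arc:
  fixes \<gamma> :: "real \<Rightarrow> complex"
  assumes cont: "continuous_on {0..t} \<gamma>" and "0 \<le> t"
    and ann: "\<And>s. s \<in> {0..t} \<Longrightarrow> 1 - \<delta> \<le> norm (\<gamma> s) \<and> norm (\<gamma> s) < 1"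
    and \<delta>: "\<delta> \<le> 1/2" "\<delta> \<le> \<epsilon> / 4" and far: "\<epsilon> \<le> norm (\<gamma> t - \<gamma> 0)" and h: "0 \<le> h" "h \<le> \<epsilon> / 2"
  obtains p where "path p" "Im (pathfinish p) = Im (pathstart p) + h" "exp ` path_image p \<subseteq> \<gamma> ` {0..t}"
proof -
  have nz: "\<gamma> s \<noteq> 0" if "s \<in> {0..t}" for s
    using ann[OF that] \<delta> by auto
  obtain l where l: "continuous_on {0..t} l" "\<And>s. s \<in> {0..t} \<Longrightarrow> \<gamma> s = exp (l s)"
    using continuous_logarithm_on_contractible[OF cont convex_imp_contractible nz] by auto
  have Re_l: "Re (l s) \<le> 0" "- (2 * \<delta>) \<le> Re (l s)" if "s \<in> {0..t}" for s
  proof -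
    have n: "norm (\<gamma> s) = exp (Re (l s))"
      using l(2)[OF that] by simp
    then show "Re (l s) \<le> 0"
      using ann[OF that] by simp
    have pos: "norm (\<gamma> s) > 0"
      using nz[OF that] by simp
    have le: "1 - \<delta> \<le> norm (\<gamma> s)" and "0 \<le> \<delta>"
      using ann[OF that] by auto
    have "- Re (l s) = ln (1 / norm (\<gamma> s))"
      using n by (simp add: ln_div)
    also have "\<dots> \<le> 1 / norm (\<gamma> s) - 1"
      using pos by (intro ln_le_minus_one) auto
    also have "\<dots> \<le> 1 / (1 - \<delta>) - 1"
      using le pos \<delta> by (simp add: frac_le)
    also have "\<dots> \<le> 2 * \<delta>"
      using \<delta> \<open>0 \<le> \<delta>\<close> mult_left_mono[of "2 * \<delta>" 1 \<delta>] by (simp add: field_simps)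
    finally show "- (2 * \<delta>) \<le> Re (l s)"
      by linarith
  qed
  define u where "u = (\<lambda>s. \<bar>Im (l s) - Im (l 0)\<bar>)"
  \<comment> \<open>As \<open>exp\<close> does not increase distances here, the logarithm moves by
    at least \<epsilon>. Its real part stays in an interval of length \<open>2 * \<delta>\<close>,
    which is at most \<open>\<epsilon> / 2\<close>, and this leaves at least \<open>h\<close> for
    the argument.\<close>
  have "\<epsilon> \<le> norm (exp (l t) - exp (l 0))"
    using far l(2)[of t] l(2)[of 0] \<open>0 \<le> t\<close> by simp
  also have "\<dots> \<le> norm (l t - l 0)"
    using Re_l \<open>0 \<le> t\<close> by (intro norm_exp_diff_le) auto
  also have "\<dots> \<le> \<bar>Re (l t) - Re (l 0)\<bar> + u t"
    using cmod_le[of "l t - l 0"] by (simp add: u_def)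
  also have "\<bar>Re (l t) - Re (l 0)\<bar> \<le> \<epsilon> / 2"
  proof -
    have "Re (l t) \<le> 0" "- (2 * \<delta>) \<le> Re (l t)" "Re (l 0) \<le> 0" "- (2 * \<delta>) \<le> Re (l 0)"
      using Re_l \<open>0 \<le> t\<close> by auto
    then show ?thesis
      using \<delta> unfolding abs_le_iff by linarith
  qed
  finally have "h \<le> u t"
    using h by simp
  moreover have "continuous_on {0..t} u"
    unfolding u_def by (intro continuous_intros l)
  ultimately obtain s where s: "0 \<le> s" "s \<le> t" "u s = h"
    using IVT'[of u 0 h t] \<open>0 \<le> t\<close> h by (auto simp: u_def)
  define p where "p = (\<lambda>x. l (x * s))"
  have sub: "x * s \<in> {0..t}" if "x \<in> {0..1}" for x
    using that s mult_left_le_one_le[of s x] by auto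
  have p: "path p" "pathstart p = l 0" "pathfinish p = l s" "exp ` path_image p \<subseteq> \<gamma> ` {0..t}"
  proof -
    show "path p"
      unfolding path_def p_def using sub
      by (intro continuous_on_compose2[OF l(1)] continuous_intros) auto
    show "exp ` path_image p \<subseteq> \<gamma> ` {0..t}"
      using sub l(2) by (force simp: path_image_def p_def)
  qed (auto simp: p_def pathstart_def pathfinish_def)
  show ?thesis
  \<comment> \<open>The argument may have gone up or down by \<open>h\<close>; in the second case
    the path is reversed.\<close>
  proof (cases "Im (l 0) \<le> Im (l s)")
    case True
    with p s show ?thesis
      by (intro that[of p]) (auto simp: u_def)
  next
    case False
    with p s show ?thesis
      by (intro that[of "reversepath p"]) (auto simp: u_def)
  qed
qed

subsection \<open>Uniform convergence of semigroups\<close>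

text \<open>Morera's theorem: after exchanging the two integrations, the integral over a triangle
  vanishes because it does so for every fixed \<open>s\<close> by Cauchy's theorem.\<close>

lemma holomorphic_on_integral_param:
  fixes g :: "complex \<Rightarrow> real \<Rightarrow> complex"
  assumes cont: "continuous_on (U \<times> {a..b}) (\<lambda>(z, s). g z s)" and "open U"
    and hol: "\<And>s. s \<in> {a..b} \<Longrightarrow> (\<lambda>z. g z s) holomorphic_on U"
  shows "(\<lambda>z. integral {a..b} (g z)) holomorphic_on U"
proof -
  have contF: "continuous_on U (\<lambda>z. integral {a..b} (g z))"
    using integral_continuous_on_param[of U a b g] cont by simp
  let ?k = "\<lambda>p q x s. g (linepath p q x) s * (q - p)"
  have lp: "contour_integral (linepath p q) h = integral {0..1} (\<lambda>x. h (linepath p q x) * (q - p))" for p q h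
    by (simp add: contour_integral_integral)
  have eq: "contour_integral (linepath p q) (\<lambda>z. integral {a..b} (g z)) =
      integral {a..b} (\<lambda>s. contour_integral (linepath p q) (\<lambda>z. g z s))"
    and int: "(\<lambda>s. contour_integral (linepath p q) (\<lambda>z. g z s)) integrable_on {a..b}"
    if "closed_segment p q \<subseteq> U" for p q
  proof -
    have sub: "linepath p q x \<in> U" if "x \<in> {0..1}" for x
      using that \<open>closed_segment p q \<subseteq> U\<close> linepath_in_path[of x p q] by auto
    have 1: "continuous_on ({0..1} \<times> {a..b}) (\<lambda>(x, s). ?k p q x s)"
      using sub unfolding split_beta
      by (intro continuous_intros continuous_on_compose2[OF cont[unfolded split_beta], of _ "\<lambda>y. (linepath p q (fst y), snd y)", simplified])
         (auto simp: linepath_def intro!: continuous_intros)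
    have 2: "continuous_on ({a..b} \<times> {0..1}) (\<lambda>(s, x). ?k p q x s)"
      using sub unfolding split_beta
      by (intro continuous_intros continuous_on_compose2[OF cont[unfolded split_beta], of _ "\<lambda>y. (linepath p q (snd y), fst y)", simplified])
         (auto simp: linepath_def intro!: continuous_intros)
    have "contour_integral (linepath p q) (\<lambda>z. integral {a..b} (g z)) =
        integral {0..1} (\<lambda>x. integral {a..b} (?k p q x))"
      by (simp add: lp)
    also have "\<dots> = integral {a..b} (\<lambda>s. integral {0..1} (\<lambda>x. ?k p q x s))"
      using integral_swap_continuous[of 0 a 1 b "?k p q"] 1 by (simp add: cbox_Pair_eq)
    finally show "contour_integral (linepath p q) (\<lambda>z. integral {a..b} (g z)) =
      integral {a..b} (\<lambda>s. contour_integral (linepath p q) (\<lambda>z. g z s))"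
      by (simp add: lp)
    have "continuous_on {a..b} (\<lambda>s. integral {0..1} (\<lambda>x. ?k p q x s))"
      using integral_continuous_on_param[of "{a..b}" 0 1 "\<lambda>s x. ?k p q x s"] 2 by simp
    then show "(\<lambda>s. contour_integral (linepath p q) (\<lambda>z. g z s)) integrable_on {a..b}"
      unfolding lp by (rule integrable_continuous_real)
  qed
  have "(\<lambda>z. integral {a..b} (g z)) analytic_on U"
  proof (rule Morera_triangle[OF contF \<open>open U\<close>], intro impI)
    fix p q r assume tri: "convex hull {p, q, r} \<subseteq> U"
    have seg: "closed_segment p q \<subseteq> U" "closed_segment q r \<subseteq> U" "closed_segment r p \<subseteq> U"
      using tri by (meson closed_segment_subset_convex_hull hull_inc insertI1 insertI2 order_trans)+
    let ?c = "\<lambda>p q s. contour_integral (linepath p q) (\<lambda>z. g z s)"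
    have "integral {a..b} (?c p q) + integral {a..b} (?c q r) + integral {a..b} (?c r p)
        = integral {a..b} (\<lambda>s. ?c p q s + ?c q r s + ?c r p s)"
      using int seg by (simp add: integral_add integrable_add)
    also have "\<dots> = integral {a..b} (\<lambda>s. 0)"
    proof (rule integral_cong)
      fix s assume "s \<in> {a..b}"
      then have "(\<lambda>z. g z s) holomorphic_on convex hull {p, q, r}"
        using hol tri holomorphic_on_subset by blast
      then have "((\<lambda>z. g z s) has_contour_integral 0) (linepath p q +++ linepath q r +++ linepath r p)"
        by (rule Cauchy_theorem_triangle)
      then show "?c p q s + ?c q r s + ?c r p s = 0"
        by (rule has_chain_integral_chain_integral3)
    qed
    finally show "contour_integral (linepath p q) (\<lambda>z. integral {a..b} (g z)) +
      contour_integral (linepath q r) (\<lambda>z. integral {a..b} (g z)) +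
      contour_integral (linepath r p) (\<lambda>z. integral {a..b} (g z)) = 0"
      by (simp add: eq seg)
  qed
  then show ?thesis
    by (rule analytic_imp_holomorphic)
qed

section \<open>Trajectories of an analytic semigroup\<close>

lemma analytic_semigroup_cont_time:
  assumes "analytic_semigroup \<phi>" "z \<in> unit_disk" "T \<subseteq> {0..}"
  shows "continuous_on T (\<lambda>s. \<phi> s z)"
proof -
  have cont: "continuous_on ({0..} \<times> unit_disk) (\<lambda>p. \<phi> (fst p) (snd p))"
    using assms(1) by (simp add: analytic_semigroup_def split_beta)
  show ?thesis
    using assms by (intro continuous_on_compose2[OF cont, of T "\<lambda>s. (s, z)", simplified] continuous_intros) auto
qed

text \<open>Uniform continuity on the compact set \<open>{0..1} \<times> cball 0 r\<close> compares
  time \<open>s\<close> with time 0, where the semigroup is the identity.\<close>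

lemma analytic_semigroup_tendsto_compact:
  assumes sg: "analytic_semigroup \<phi>" and "r < 1" "0 < e"
  obtains d where "0 < d" "\<And>s z. 0 \<le> s \<Longrightarrow> s \<le> d \<Longrightarrow> norm z \<le> r \<Longrightarrow> norm (\<phi> s z - z) < e"
proof -
  have cont: "continuous_on ({0..} \<times> unit_disk) (\<lambda>(t, z). \<phi> t z)"
    and id: "\<And>z. z \<in> unit_disk \<Longrightarrow> \<phi> 0 z = z"
    using sg by (auto simp: analytic_semigroup_def)
  have "uniformly_continuous_on ({0..1} \<times> cball 0 r) (\<lambda>(t, z). \<phi> t z)"
    using \<open>r < 1\<close>
    by (intro compact_uniformly_continuous continuous_on_subset[OF cont] compact_Times) auto
  then obtain d where d: "d > 0" "\<And>x y. x \<in> {0..1} \<times> cball 0 r \<Longrightarrow> y \<in> {0..1} \<times> cball 0 r \<Longrightarrow>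
      dist y x < d \<Longrightarrow> dist (case y of (t, z) \<Rightarrow> \<phi> t z) (case x of (t, z) \<Rightarrow> \<phi> t z) < e"
    using \<open>0 < e\<close> by (force simp: uniformly_continuous_on_def)
  show ?thesis
  proof
    show "0 < min 1 (d / 2)"
      using d by simp
    show "norm (\<phi> s z - z) < e" if "0 \<le> s" "s \<le> min 1 (d / 2)" "norm z \<le> r" for s z
      using d(2)[of "(0, z)" "(s, z)"] that d(1) id[of z] \<open>r < 1\<close> by (simp add: dist_Pair_Pair dist_norm)
  qed
qed

text \<open>By the semigroup law, composition with \<open>\<phi> s\<close> moves the window of
  integration from \<open>{0..a}\<close> to \<open>{s..a + s}\<close>, and the two integrals differ
  by integrals over two intervals of length \<open>s\<close>. For small \<open>a\<close> the
  function is close to \<open>a * z\<close> near 0, which keeps its derivative away from 0.\<close>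

lemma analytic_semigroup_lipschitz_fun:
  assumes sg: "analytic_semigroup \<phi>"
  obtains f B where "f holomorphic_on unit_disk" "\<And>z. z \<in> unit_disk \<Longrightarrow> norm (f z) \<le> B" "deriv f 0 \<noteq> 0"
    "\<And>s z. 0 \<le> s \<Longrightarrow> z \<in> unit_disk \<Longrightarrow> norm (f (\<phi> s z) - f z) \<le> 2 * s"
proof -
  have hol: "\<And>t. 0 \<le> t \<Longrightarrow> \<phi> t holomorphic_on unit_disk"
    and maps: "\<And>t z. 0 \<le> t \<Longrightarrow> z \<in> unit_disk \<Longrightarrow> \<phi> t z \<in> unit_disk"
    and semi: "\<And>s t z. 0 \<le> s \<Longrightarrow> 0 \<le> t \<Longrightarrow> z \<in> unit_disk \<Longrightarrow> \<phi> (s + t) z = \<phi> s (\<phi> t z)"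
    and cont: "continuous_on ({0..} \<times> unit_disk) (\<lambda>p. \<phi> (fst p) (snd p))"
    using sg unfolding analytic_semigroup_def split_beta by blast+
  \<comment> \<open>The numbers fit Cauchy's inequality: on the circle of radius \<open>1/2\<close>
    the function \<open>f z - of_real a * z\<close> is at most \<open>a / 4\<close>, so its
    derivative at 0 is at most \<open>a / 2\<close>, less than \<open>a\<close>.\<close>
  obtain a where a: "0 < a" "\<And>s z. 0 \<le> s \<Longrightarrow> s \<le> a \<Longrightarrow> norm z \<le> 1/2 \<Longrightarrow> norm (\<phi> s z - z) < 1/4"
    using analytic_semigroup_tendsto_compact[OF sg, of "1/2" "1/4"] by auto
  define f where "f = (\<lambda>z. integral {0..a} (\<lambda>s. \<phi> s z))"
  have int: "(\<lambda>s. \<phi> s z) integrable_on {b..c}" if "0 \<le> b" "z \<in> unit_disk" for b c z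
    using that by (intro integrable_continuous_real analytic_semigroup_cont_time[OF sg]) auto
  have bound: "norm (integral {b..c} (\<lambda>s. \<phi> s z)) \<le> c - b" if "0 \<le> b" "b \<le> c" "z \<in> unit_disk" for b c z
  proof -
    have "norm (integral {b..c} (\<lambda>s. \<phi> s z)) \<le> 1 * (c - b)"
      using that maps[of _ z]
      by (intro integral_bound analytic_semigroup_cont_time[OF sg]) (auto simp: less_imp_le)
    then show ?thesis
      by simp
  qed
  have f_hol: "f holomorphic_on unit_disk"
    unfolding f_def
  proof (rule holomorphic_on_integral_param)
    show "continuous_on (unit_disk \<times> {0..a}) (\<lambda>(z, s). \<phi> s z)"
      unfolding split_beta
      by (intro continuous_on_compose2[OF cont, of _ "\<lambda>x. (snd x, fst x)", simplified] continuous_intros) auto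
  qed (auto intro: hol)
  show ?thesis
  proof (rule that[OF f_hol])
    show "norm (f z) \<le> a" if "z \<in> unit_disk" for z
      using bound[of 0 a z] that a by (simp add: f_def)
    show "norm (f (\<phi> s z) - f z) \<le> 2 * s" if "0 \<le> s" "z \<in> unit_disk" for s z
    proof -
      let ?I = "\<lambda>b c. integral {b..c} (\<lambda>s. \<phi> s z)"
      have "f (\<phi> s z) = integral {0..a} (\<lambda>r. \<phi> (r + s) z)"
        unfolding f_def using semi that by (intro integral_cong) auto
      also have "\<dots> = ?I s (a + s)"
        using integral_shift_Icc_real[of 0 a "\<lambda>s. \<phi> s z" s] by (simp add: o_def add.commute)
      finally have fs: "f (\<phi> s z) = ?I s (a + s)" .
      \<comment> \<open>Both sides are the integral over \<open>{0..a + s}\<close>; no distinction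
        between \<open>s \<le> a\<close> and \<open>s > a\<close> is necessary.\<close>
      have "?I 0 s + ?I s (a + s) = ?I 0 a + ?I a (a + s)"
        using int[of 0 z "a + s"] that a by (subst (1 2) Henstock_Kurzweil_Integration.integral_combine) auto
      then have "f (\<phi> s z) - f z = ?I a (a + s) - ?I 0 s"
        unfolding fs by (simp add: f_def algebra_simps)
      also have "norm \<dots> \<le> s + s"
        using bound[of a "a + s" z] bound[of 0 s z] that a by (intro norm_triangle_le_diff) auto
      finally show ?thesis
        by simp
    qed
    let ?h = "\<lambda>z. f z - of_real a * z"
    have h_hol: "?h holomorphic_on unit_disk"
      by (intro holomorphic_intros f_hol)
    have "norm ((deriv ^^ 1) ?h 0) \<le> fact 1 * (a / 4) / (1/2) ^ 1"
    proof (rule Cauchy_inequality)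
      show "?h holomorphic_on ball 0 (1/2)"
        by (rule holomorphic_on_subset[OF h_hol]) auto
      show "continuous_on (cball 0 (1/2)) ?h"
        by (rule holomorphic_on_imp_continuous_on, rule holomorphic_on_subset[OF h_hol]) auto
      show "norm (?h z) \<le> a / 4" if "norm (0 - z) = 1/2" for z
      proof -
        have z: "z \<in> unit_disk"
          using that by simp
        have "?h z = integral {0..a} (\<lambda>s. \<phi> s z - z)"
          unfolding f_def using int[of 0 z a] z a
          by (subst Henstock_Kurzweil_Integration.integral_diff) (auto simp: scaleR_conv_of_real)
        also have "norm \<dots> \<le> 1/4 * (a - 0)"
          using a z that by (intro integral_bound continuous_intros analytic_semigroup_cont_time[OF sg])
            (auto intro!: less_imp_le)
        finally show ?thesis
          by simp
      qed
    qed auto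
    moreover have "deriv ?h 0 = deriv f 0 - a"
    proof -
      have "(f has_field_derivative deriv f 0) (at 0)"
        using holomorphic_derivI[OF f_hol, of 0] by simp
      then show ?thesis
        by (intro DERIV_imp_deriv) (auto intro!: derivative_eq_intros)
    qed
    ultimately show "deriv f 0 \<noteq> 0"
      using a by auto
  qed
qed

text \<open>If a point moves by \<epsilon> in time \<open>t\<close>, its trajectory supplies an arc
  on which the Lipschitz function \<open>f\<close> is constant up to \<open>2 * t\<close>. Koebe's
  bound then contradicts \<open>deriv f 0 \<noteq> 0\<close> for small \<open>t\<close>.\<close>

lemma analytic_semigroup_tendsto_uniformly:
  assumes sg: "analytic_semigroup \<phi>" and "0 < \<epsilon>"
  obtains d where "0 < d" "\<And>t z. 0 \<le> t \<Longrightarrow> t < d \<Longrightarrow> z \<in> unit_disk \<Longrightarrow> norm (\<phi> t z - z) < \<epsilon>"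
proof -
  have maps: "\<And>t z. 0 \<le> t \<Longrightarrow> z \<in> unit_disk \<Longrightarrow> \<phi> t z \<in> unit_disk"
    and semi: "\<And>s t z. 0 \<le> s \<Longrightarrow> 0 \<le> t \<Longrightarrow> z \<in> unit_disk \<Longrightarrow> \<phi> (s + t) z = \<phi> s (\<phi> t z)"
    and id: "\<And>z. z \<in> unit_disk \<Longrightarrow> \<phi> 0 z = z"
    using sg unfolding analytic_semigroup_def by blast+
  obtain f B where f: "f holomorphic_on unit_disk" "\<And>z. z \<in> unit_disk \<Longrightarrow> norm (f z) \<le> B" "deriv f 0 \<noteq> 0"
    "\<And>s z. 0 \<le> s \<Longrightarrow> z \<in> unit_disk \<Longrightarrow> norm (f (\<phi> s z) - f z) \<le> 2 * s"
    using analytic_semigroup_lipschitz_fun[OF sg] by blast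
  define \<delta> where "\<delta> = min (1/2) (\<epsilon> / 4)"
  have \<delta>: "0 < \<delta>" "\<delta> \<le> 1/2" "\<delta> \<le> \<epsilon> / 4"
    using \<open>0 < \<epsilon>\<close> by (auto simp: \<delta>_def)
  \<comment> \<open>The angle of the arc is fixed by \<epsilon> alone, so the exponents in Koebe's
    bound do not depend on \<open>t\<close>.\<close>
  obtain M where M: "pi / of_nat (Suc M) \<le> \<epsilon> / 2"
  proof -
    have "\<epsilon> / (2 * pi) > 0"
      using \<open>0 < \<epsilon>\<close> by simp
    then obtain M where "inverse (of_nat (Suc M)) < \<epsilon> / (2 * pi)"
      using reals_Archimedean by blast
    then have "pi / of_nat (Suc M) \<le> \<epsilon> / 2"
      by (simp add: field_simps)
    then show ?thesis
      by (rule that)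
  qed
  \<comment> \<open>This is the bound of \<open>koebe_arc_deriv_bound\<close> with
    \<open>2 * t\<close> for \<eta>; it is continuous and vanishes at 0.\<close>
  define b where "b = (\<lambda>t. (4 * B) ^ (2 * M + 1) *
    (2 * (2 * t + root (2 * Suc M) ((2 * B) ^ (2 * M + 1) * (2 * t)))))"
  have "isCont b 0"
    unfolding b_def by (intro continuous_intros)
  then have "(b \<longlongrightarrow> 0) (at 0)"
    by (simp add: isCont_def b_def)
  moreover have "0 < norm (deriv f 0) ^ (2 * Suc M)"
    using f by simp
  ultimately have "\<forall>\<^sub>F t in at 0. b t < norm (deriv f 0) ^ (2 * Suc M)"
    by (rule order_tendstoD)
  then obtain d2 where d2: "0 < d2" "\<And>t. t \<noteq> 0 \<Longrightarrow> norm t < d2 \<Longrightarrow> b t < norm (deriv f 0) ^ (2 * Suc M)"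
    by (auto simp: eventually_at dist_norm)
  obtain d1 where d1: "0 < d1" "\<And>s z. 0 \<le> s \<Longrightarrow> s \<le> d1 \<Longrightarrow> norm z \<le> 1 - \<delta> / 2 \<Longrightarrow>
      norm (\<phi> s z - z) < min \<epsilon> (\<delta> / 2)"
    using analytic_semigroup_tendsto_compact[OF sg, of "1 - \<delta> / 2" "min \<epsilon> (\<delta> / 2)"] \<delta> \<open>0 < \<epsilon>\<close> by auto
  show ?thesis
  proof (rule that[of "min d1 d2"])
    fix t z
    assume t: "0 \<le> t" "t < min d1 d2" and z: "z \<in> unit_disk"
    show "norm (\<phi> t z - z) < \<epsilon>"
    proof (rule ccontr)
      assume far: "\<not> norm (\<phi> t z - z) < \<epsilon>"
      then have z_out: "1 - \<delta> / 2 < norm z"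
        using d1(2)[of t z] t by fastforce
      have "t \<noteq> 0"
        using far id[OF z] \<open>0 < \<epsilon>\<close> by auto
      have cont: "continuous_on {0..s} (\<lambda>s. \<phi> s z)" for s
        by (rule analytic_semigroup_cont_time[OF sg z]) auto
      \<comment> \<open>A trajectory that starts outside radius \<open>1 - \<delta> / 2\<close> and
        dips below \<open>1 - \<delta>\<close> crosses the circle of radius
        \<open>1 - \<delta> / 2\<close> at some time \<open>r\<close>. Restarted there, it moves by
        less than \<open>\<delta> / 2\<close> in the remaining time and cannot get that
        deep.\<close>
      have ann: "1 - \<delta> \<le> norm (\<phi> s z)" if s: "s \<in> {0..t}" for s
      proof (rule ccontr)
        assume c: "\<not> 1 - \<delta> \<le> norm (\<phi> s z)"
        obtain r where r: "0 \<le> r" "r \<le> s" "norm (\<phi> r z) = 1 - \<delta> / 2"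
          using continuous_on_norm[OF cont[of s]] IVT2'[of "\<lambda>s. norm (\<phi> s z)" s "1 - \<delta> / 2" 0] c s z_out \<delta> id[OF z]
          by auto
        have "\<phi> s z = \<phi> (s - r) (\<phi> r z)"
          using semi[of "s - r" r z] r z by simp
        then have "norm (\<phi> s z - \<phi> r z) < \<delta> / 2"
          using d1(2)[of "s - r" "\<phi> r z"] r s t by simp
        moreover have "norm (\<phi> r z) - norm (\<phi> s z) \<le> norm (\<phi> s z - \<phi> r z)"
          by (metis norm_minus_commute norm_triangle_ineq2)
        ultimately show False
          using r c by linarith
      qed
      obtain p where p: "path p" "Im (pathfinish p) = Im (pathstart p) + pi / of_nat (Suc M)"
        "exp ` path_image p \<subseteq> (\<lambda>s. \<phi> s z) ` {0..t}"
      proof (rule exists_log_arc[OF cont t(1) _ \<delta>(2,3) _ _ M])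
        show "1 - \<delta> \<le> norm (\<phi> s z) \<and> norm (\<phi> s z) < 1" if "s \<in> {0..t}" for s
          using ann[OF that] maps[of s z] z that by auto
        show "\<epsilon> \<le> norm (\<phi> t z - \<phi> 0 z)"
          using far id[OF z] by simp
      qed auto
      \<comment> \<open>The constant of the Koebe bound is \<open>f z\<close>: the arc consists of
        points \<open>\<phi> s z\<close> with \<open>s \<le> t\<close>, where \<open>f\<close>
        differs from \<open>f z\<close> by at most \<open>2 * t\<close>.\<close>
      have "norm (deriv f 0) ^ (2 * Suc M) \<le> b t"
        unfolding b_def
      proof (rule koebe_arc_deriv_bound[OF f(1,2) p(1) _ p(2)])
        show "exp ` path_image p \<subseteq> unit_disk - ball 0 (1/2)"
        proof
          fix w assume "w \<in> exp ` path_image p"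
          then obtain s where "s \<in> {0..t}" "w = \<phi> s z"
            using p by blast
          then show "w \<in> unit_disk - ball 0 (1/2)"
            using ann[of s] maps[of s z] z \<delta> by auto
        qed
        show "norm (f (exp w) - f z) \<le> 2 * t" if w: "w \<in> path_image p" for w
        proof -
          obtain s where s: "s \<in> {0..t}" "exp w = \<phi> s z"
            using p w by blast
          then show ?thesis
            using f(4)[of s z] z by auto
        qed
      qed (use f z in auto)
      then show False
        using d2(2)[of t] t \<open>t \<noteq> 0\<close> by auto
    qed
  qed (use d1 d2 in auto)
qed

subsection \<open>Continuous inclusions of Banach spaces of analytic functions\<close>

context normed_analytic_space
begin

lemma zero_mem: "0 \<in> X"
  and add_mem: "f \<in> X \<Longrightarrow> g \<in> X \<Longrightarrow> f + g \<in> X"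
  and diff_mem: "f \<in> X \<Longrightarrow> g \<in> X \<Longrightarrow> f - g \<in> X"
  and scale_mem: "f \<in> X \<Longrightarrow> fscale c f \<in> X"
  using subspace by (auto intro: fun_space.subspace_0 fun_space.subspace_add
      fun_space.subspace_diff fun_space.subspace_scale)

lemma norm_zero: "N 0 = 0"
  using norm_eq_0 zero_mem by blast

lemma norm_minus_swap: "f \<in> X \<Longrightarrow> g \<in> X \<Longrightarrow> N (f - g) = N (g - f)"
  using commute[of f g] by (simp add: norm_dist_def)

lemma norm_diff_triangle: "f \<in> X \<Longrightarrow> g \<in> X \<Longrightarrow> h \<in> X \<Longrightarrow> N (f - h) \<le> N (f - g) + N (g - h)"
  using triangle[of f g h] by (simp add: norm_dist_def)

lemma outside_disk: "f \<in> X \<Longrightarrow> z \<notin> unit_disk \<Longrightarrow> f z = 0"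
  using analytic by (auto simp: H_disk_def)

end

lemma (in banach_analytic_space) tendsto_eval:
  assumes "limitin mtopology \<sigma> l F" "z \<in> unit_disk"
  shows "((\<lambda>n. \<sigma> n z) \<longlongrightarrow> l z) F"
  using continuous_map_limit[OF eval_continuous[OF assms(2)] assms(1)] by (simp add: o_def)

lemma limitin_norm_topology:
  assumes "normed_analytic_space X N" "\<And>n. \<sigma> n \<in> X" "l \<in> X" "(\<lambda>n. N (\<sigma> n - l)) \<longlonglongrightarrow> 0"
  shows "limitin (norm_topology X N) \<sigma> l sequentially"
proof -
  interpret normed_analytic_space X N
    by fact
  show ?thesis
    using assms unfolding norm_topology_def limitin_metric_dist_null by (simp add: norm_dist_def)
qed

text \<open>The closed graph theorem applies to the inclusion because point evaluations are continuous on
  both sides.\<close>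

lemma banach_analytic_space_inclusion_bounded:
  assumes "banach_analytic_space X N" "banach_analytic_space Y M" "Y \<subseteq> X"
  obtains C where "\<And>f. f \<in> Y \<Longrightarrow> N f \<le> C * M f"
proof -
  interpret X: banach_analytic_space X N by fact
  interpret Y: banach_analytic_space Y M by fact
  \<comment> \<open>Baire category: these closed sets exhaust the complete space \<open>Y\<close>,
    so one of them contains a ball.\<close>
  define T where "T = (\<lambda>k::nat. Y.mtopology closure_of {f \<in> Y. N f \<le> real k})"
  have "\<Union> (range T) = Y"
  proof
    show "\<Union> (range T) \<subseteq> Y"
      by (auto simp: T_def Y.metric_closure_of)
    show "Y \<subseteq> \<Union> (range T)"
    proof
      fix f assume "f \<in> Y"
      moreover obtain k where "N f \<le> real k"
        using real_arch_simple by blast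
      ultimately have "f \<in> T k"
        unfolding T_def by (intro closure_of_subset[THEN subsetD]) auto
      then show "f \<in> \<Union> (range T)"
        by blast
    qed
  qed
  then have "Y.mtopology interior_of \<Union> (range T) \<noteq> {}"
    using Y.zero_mem interior_of_topspace[of Y.mtopology] by auto
  moreover have "Y.mtopology interior_of \<Union> (range T) = {}" if "\<And>k. Y.mtopology interior_of T k = {}"
    using that by (intro Y.metric_Baire_category_alt[OF Y.complete]) (auto simp: T_def)
  ultimately obtain k where "Y.mtopology interior_of T k \<noteq> {}"
    by blast
  then obtain g0 \<rho> where g0: "g0 \<in> Y" "0 < \<rho>" "Y.mball g0 \<rho> \<subseteq> T k"
    by (auto simp: Y.metric_interior_of)
  have T_approx: "\<exists>u\<in>Y. N u \<le> real k \<and> M (f - u) < e" if "f \<in> T k" "0 < e" for f e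
    using that by (auto simp: T_def Y.metric_closure_of norm_dist_def dest!: spec[of _ e])
  \<comment> \<open>Subtracting approximants of \<open>g0 + f\<close> and of \<open>g0\<close> moves
    the centre of the ball to 0, at the price of a factor 2.\<close>
  have approx: "\<exists>w\<in>Y. N w \<le> 2 * real k \<and> M (f - w) < e" if f: "f \<in> Y" "M f < \<rho>" and "0 < e" for f e
  proof -
    have gf: "g0 + f \<in> Y"
      using g0 f by (simp add: Y.add_mem)
    have "M (g0 - (g0 + f)) = M f"
      using Y.norm_minus_swap[OF g0(1) gf] by simp
    then have "g0 + f \<in> T k" "g0 \<in> T k"
      using g0 f gf Y.norm_zero by (auto simp: norm_dist_def intro!: subsetD[OF g0(3)])
    then obtain u v where u: "u \<in> Y" "N u \<le> real k" "M (g0 + f - u) < e / 2"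
      and v: "v \<in> Y" "N v \<le> real k" "M (g0 - v) < e / 2"
      using T_approx \<open>0 < e\<close> by (meson half_gt_zero)
    have "N (u - v) \<le> N (u - 0) + N (0 - v)"
      using u v \<open>Y \<subseteq> X\<close> X.zero_mem by (intro X.norm_diff_triangle) auto
    also have "N (0 - v) = N (v - 0)"
      using v \<open>Y \<subseteq> X\<close> X.zero_mem by (intro X.norm_minus_swap) auto
    finally have "N (u - v) \<le> N u + N v"
      by (simp only: diff_0_right)
    then have "N (u - v) \<le> 2 * real k"
      using u v by linarith
    moreover have "M (f - (u - v)) < e"
    proof -
      have "M ((g0 + f - u) - (g0 - v)) \<le> M ((g0 + f - u) - 0) + M (0 - (g0 - v))"
        using u v gf g0 by (intro Y.norm_diff_triangle Y.diff_mem Y.zero_mem)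
      also have "M (0 - (g0 - v)) = M (g0 - v)"
        using Y.norm_minus_swap[of 0 "g0 - v"] v g0 by (simp add: Y.zero_mem Y.diff_mem)
      finally have "M ((g0 + f - u) - (g0 - v)) < e"
        unfolding diff_0_right using u v by linarith
      moreover have "(g0 + f - u) - (g0 - v) = f - (u - v)"
        by (simp add: algebra_simps)
      ultimately show ?thesis
        by (simp only:)
    qed
    ultimately show ?thesis
      using u v Y.diff_mem by blast
  qed
  have approx': "\<exists>w\<in>Y. N w \<le> 2 * real k * (1/2) ^ n \<and> M (f - w) < \<rho> * (1/2) ^ Suc n"
    if f: "f \<in> Y" "M f < \<rho> * (1/2) ^ n" for f and n :: nat
  proof -
    have "M (fscale (2 ^ n) f) < \<rho>"
      using f by (simp add: Y.norm_scale norm_power field_simps)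
    then obtain w where w: "w \<in> Y" "N w \<le> 2 * real k" "M (fscale (2 ^ n) f - w) < \<rho> / 2"
      using approx[of "fscale (2 ^ n) f" "\<rho> / 2"] f g0 Y.scale_mem by auto
    let ?w = "fscale ((1/2) ^ n) w"
    have "f - ?w = fscale ((1/2) ^ n) (fscale (2 ^ n) f - w)"
      by (auto simp: fscale_def fun_eq_iff field_simps)
    then have "M (f - ?w) = (1/2) ^ n * M (fscale (2 ^ n) f - w)"
      using w f by (simp only:) (simp add: Y.norm_scale Y.diff_mem Y.scale_mem norm_power norm_divide)
    then have "M (f - ?w) < \<rho> * (1/2) ^ Suc n"
      using w by (simp add: field_simps)
    moreover have "N ?w \<le> 2 * real k * (1/2) ^ n"
      using w \<open>Y \<subseteq> X\<close> X.norm_scale[of w "(1/2) ^ n"] by (auto simp: norm_power norm_divide field_simps)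
    ultimately show ?thesis
      using w Y.scale_mem by blast
  qed
  \<comment> \<open>Successive approximation: the increments are dominated in \<open>N\<close> by a
    geometric series with sum \<open>4 * real k\<close>, while the partial sums tend to
    \<open>f\<close> in \<open>Y\<close>.\<close>
  have ball: "N f \<le> 4 * real k" if f: "f \<in> Y" "M f < \<rho>" for f
  proof -
    \<comment> \<open>The starting value is prescribed through the invariant, hence its clause for
      \<open>n = 0\<close>.\<close>
    have "\<exists>s. \<forall>n. (s n \<in> Y \<and> M (f - s n) < \<rho> * (1/2) ^ n \<and> (n = 0 \<longrightarrow> s n = 0)) \<and>
        N (s (Suc n) - s n) \<le> 2 * real k * (1/2) ^ n"
    proof (rule dependent_nat_choice)
      show "\<exists>x. x \<in> Y \<and> M (f - x) < \<rho> * (1/2) ^ 0 \<and> (0 = (0::nat) \<longrightarrow> x = 0)"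
        using f Y.zero_mem by (intro exI[of _ 0]) auto
      fix x and n :: nat
      assume x: "x \<in> Y \<and> M (f - x) < \<rho> * (1/2) ^ n \<and> (n = 0 \<longrightarrow> x = 0)"
      then obtain w where "w \<in> Y" "N w \<le> 2 * real k * (1/2) ^ n" "M (f - x - w) < \<rho> * (1/2) ^ Suc n"
        using approx'[of "f - x" n] f Y.diff_mem by blast
      then show "\<exists>y. (y \<in> Y \<and> M (f - y) < \<rho> * (1/2) ^ Suc n \<and> (Suc n = 0 \<longrightarrow> y = 0)) \<and>
          N (y - x) \<le> 2 * real k * (1/2) ^ n"
        using x Y.add_mem by (intro exI[of _ "x + w"]) (auto simp: algebra_simps)
    qed
    then obtain s where s: "\<And>n. s n \<in> Y" "\<And>n. M (f - s n) < \<rho> * (1/2) ^ n" "s 0 = 0"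
      "\<And>n. N (s (Suc n) - s n) \<le> 2 * real k * (1/2) ^ n"
      by blast
    have sX: "s n \<in> X" for n
      using s \<open>Y \<subseteq> X\<close> by blast
    have tail: "N (s (n + j) - s n) \<le> 4 * real k * ((1/2) ^ n - (1/2) ^ (n + j))" for n j
    proof (induction j)
      case (Suc j)
      have "N (s (n + Suc j) - s n) \<le> N (s (n + Suc j) - s (n + j)) + N (s (n + j) - s n)"
        using sX by (intro X.norm_diff_triangle)
      also have "\<dots> \<le> 2 * real k * (1/2) ^ (n + j) + 4 * real k * ((1/2) ^ n - (1/2) ^ (n + j))"
        unfolding add_Suc_right by (intro add_mono Suc s(4))
      also have "\<dots> = 4 * real k * ((1/2) ^ n - (1/2) ^ (n + Suc j))"
        by (simp add: algebra_simps)
      finally show ?case .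
    qed (simp add: X.norm_zero[unfolded zero_fun_def])
    have tail': "N (s m - s n) \<le> 4 * real k * (1/2) ^ n" if "n \<le> m" for m n
    proof -
      have "4 * real k * ((1/2) ^ n - (1/2) ^ m) \<le> 4 * real k * (1/2) ^ n"
        by (intro mult_left_mono) auto
      then show ?thesis
        using tail[of n "m - n"] that unfolding le_add_diff_inverse[OF that] by linarith
    qed
    have lim0: "(\<lambda>n. c * (1/2) ^ n) \<longlonglongrightarrow> 0" for c :: real
      by (intro tendsto_mult_right_zero LIMSEQ_power_zero) auto
    have "X.MCauchy s"
      unfolding X.MCauchy_def
    proof (intro conjI allI impI)
      fix e :: real assume "e > 0"
      then have "\<forall>\<^sub>F n in sequentially. 4 * real k * (1/2) ^ n < e"
        using order_tendstoD(2)[OF lim0] by blast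
      then obtain n0 where n0: "\<And>n. n \<ge> n0 \<Longrightarrow> 4 * real k * (1/2) ^ n < e"
        by (auto simp: eventually_sequentially)
      have "N (s n - s n') < e" if "n0 \<le> n" "n0 \<le> n'" for n n'
      proof (cases "n \<le> n'")
        case True
        then show ?thesis
          using tail'[of n n'] n0[of n] that X.norm_minus_swap[OF sX sX, of n n'] by simp
      next
        case False
        then show ?thesis
          using tail'[of n' n] n0[of n'] that by simp
      qed
      then show "\<exists>n0. \<forall>n n'. n0 \<le> n \<longrightarrow> n0 \<le> n' \<longrightarrow> norm_dist X N (s n) (s n') < e"
        using sX by (auto simp: norm_dist_def)
    qed (use sX in auto)
    then obtain F where F: "limitin X.mtopology s F sequentially"
      using X.complete by (auto simp: X.mcomplete_def)
    have limY: "limitin Y.mtopology s f sequentially"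
      unfolding norm_topology_def[symmetric]
    proof (rule limitin_norm_topology)
      show "(\<lambda>n. M (s n - f)) \<longlonglongrightarrow> 0"
      proof (rule tendsto_sandwich[OF _ _ tendsto_const lim0[of \<rho>]])
        show "\<forall>\<^sub>F n in sequentially. 0 \<le> M (s n - f)"
          using s f by (intro always_eventually allI Y.norm_nonneg Y.diff_mem)
        show "\<forall>\<^sub>F n in sequentially. M (s n - f) \<le> \<rho> * (1/2) ^ n"
          using s(2) Y.norm_minus_swap[OF s(1) f(1)] by (intro always_eventually allI) (simp add: less_imp_le)
      qed
    qed (use s f Y.normed_analytic_space_axioms in auto)
    \<comment> \<open>This is the closedness of the graph: the limits in \<open>X\<close> and in
      \<open>Y\<close> have the same values on the disk, and both vanish off it.\<close>
    have "F = f"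
    proof
      fix z
      show "F z = f z"
      proof (cases "z \<in> unit_disk")
        case True
        then show ?thesis
          using LIMSEQ_unique[OF X.tendsto_eval[OF F] Y.tendsto_eval[OF limY]] by blast
      next
        case False
        then show ?thesis
          using X.outside_disk[OF X.limitin_mspace[OF F] False] Y.outside_disk[OF f(1) False] by simp
      qed
    qed
    then have "(\<lambda>n. N (s n - f)) \<longlonglongrightarrow> 0" "f \<in> X"
      using F sX unfolding X.limitin_metric_dist_null by (auto simp: norm_dist_def)
    then have lim: "(\<lambda>n. N (s n - f) + 4 * real k) \<longlonglongrightarrow> 0 + 4 * real k"
      by (intro tendsto_intros)
    have "N f \<le> N (s n - f) + 4 * real k" for n
    proof -
      have "N (f - 0) \<le> N (f - s n) + N (s n - 0)"
        using sX X.zero_mem \<open>f \<in> X\<close> by (intro X.norm_diff_triangle)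
      then show ?thesis
        using tail'[of 0 n] s(3) X.norm_minus_swap[OF \<open>f \<in> X\<close> sX] by simp
    qed
    then show ?thesis
      using LIMSEQ_le_const[OF lim] by auto
  qed
  show ?thesis
  proof (rule that[of "8 * real k / \<rho>"])
    fix f assume f: "f \<in> Y"
    show "N f \<le> 8 * real k / \<rho> * M f"
    proof (cases "f = 0")
      case True
      then show ?thesis
        by (simp add: X.norm_zero Y.norm_zero)
    next
      case False
      then have pos: "M f > 0"
        using Y.norm_nonneg[OF f] Y.norm_eq_0[OF f] by simp
      \<comment> \<open>The multiple of \<open>f\<close> by \<open>c\<close> has norm
        \<open>\<rho> / 2\<close> in \<open>Y\<close>, so \<open>ball\<close> applies to it;
        dividing by \<open>c\<close> produces the constant
        \<open>8 * real k / \<rho>\<close>.\<close>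
      define c where "c = \<rho> / (2 * M f)"
      have c: "0 < c" "c * M f < \<rho>"
        using pos g0 by (auto simp: c_def)
      have "N (fscale (of_real c) f) \<le> 4 * real k"
        using f c by (intro ball) (auto simp: Y.norm_scale Y.scale_mem)
      then have "c * N f \<le> 4 * real k"
        using f \<open>Y \<subseteq> X\<close> c by (subst (asm) X.norm_scale) auto
      then show ?thesis
        using pos g0 by (simp add: c_def field_simps)
    qed
  qed
qed

subsection \<open>Bounded functions and the strongly continuous subspace\<close>

text \<open>Meaningful for functions bounded on the disk; otherwise the supremum is an unspecified
  real.\<close>

definition sup_norm :: "(complex \<Rightarrow> complex) \<Rightarrow> real" where
  "sup_norm f = (SUP z\<in>unit_disk. norm (f z))"

lemma sup_norm_le: "(\<And>z. z \<in> unit_disk \<Longrightarrow> norm (f z) \<le> c) \<Longrightarrow> sup_norm f \<le> c"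
  unfolding sup_norm_def by (rule cSUP_least) auto

lemma norm_le_sup_norm:
  assumes "f \<in> H_infty" "z \<in> unit_disk"
  shows "norm (f z) \<le> sup_norm f"
proof -
  have "bdd_above ((\<lambda>z. norm (f z)) ` unit_disk)"
    using assms(1) by (auto simp: H_infty_def bounded_iff bdd_above_def)
  then show ?thesis
    unfolding sup_norm_def using assms(2) by (intro cSUP_upper) auto
qed

lemma H_inftyI:
  assumes "f holomorphic_on unit_disk" "\<And>z. z \<notin> unit_disk \<Longrightarrow> f z = 0" "\<And>z. z \<in> unit_disk \<Longrightarrow> norm (f z) \<le> B"
  shows "f \<in> H_infty"
  using assms by (auto simp: H_infty_def H_disk_def bounded_iff intro!: exI[of _ B])

lemma H_inftyD:
  assumes "f \<in> H_infty"
  shows "f holomorphic_on unit_disk" "z \<notin> unit_disk \<Longrightarrow> f z = 0"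
  using assms by (auto simp: H_infty_def H_disk_def)

lemma normed_analytic_space_H_infty: "normed_analytic_space H_infty sup_norm"
proof
  have scale: "fscale c f \<in> H_infty" if "f \<in> H_infty" for c f
  proof (rule H_inftyI)
    show "norm (fscale c f z) \<le> norm c * sup_norm f" if "z \<in> unit_disk" for z
      using norm_le_sup_norm[OF \<open>f \<in> H_infty\<close> that] by (auto simp: fscale_def norm_mult mult_left_mono)
  qed (use H_inftyD[OF that] in \<open>auto simp: fscale_def intro!: holomorphic_intros\<close>)
  have add_le: "norm ((f + g) z) \<le> sup_norm f + sup_norm g"
    if "f \<in> H_infty" "g \<in> H_infty" "z \<in> unit_disk" for f g z
    using norm_le_sup_norm[of f z] norm_le_sup_norm[of g z] that
    by (auto intro: norm_triangle_le)
  show "H_infty \<subseteq> H_disk"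
    by (auto simp: H_infty_def)
  show "fun_space.subspace H_infty"
  proof (rule fun_space.subspaceI)
    show "0 \<in> H_infty"
      by (rule H_inftyI[where B = 0]) (auto simp: zero_fun_def)
    show "f + g \<in> H_infty" if "f \<in> H_infty" "g \<in> H_infty" for f g
    proof (rule H_inftyI)
      show "f + g holomorphic_on unit_disk"
        using H_inftyD[OF that(1)] H_inftyD[OF that(2)] unfolding plus_fun_def by (intro holomorphic_intros)
    qed (use that add_le H_inftyD(2)[OF that(1)] H_inftyD(2)[OF that(2)] in auto)
  qed (rule scale)
  fix f assume f: "f \<in> H_infty"
  show nonneg: "0 \<le> sup_norm f"
    using norm_le_sup_norm[OF f, of 0] by (auto intro: order_trans[OF norm_ge_zero])
  show "sup_norm f = 0 \<longleftrightarrow> f = 0"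
  proof
    assume "sup_norm f = 0"
    then have "f z = 0" for z
      using norm_le_sup_norm[OF f, of z] H_inftyD(2)[OF f, of z] by (cases "z \<in> unit_disk") auto
    then show "f = 0"
      by auto
  qed (simp add: sup_norm_def)
  show "sup_norm (f + g) \<le> sup_norm f + sup_norm g" if "g \<in> H_infty" for g
    using add_le f that by (intro sup_norm_le)
  show "sup_norm (fscale c f) = norm c * sup_norm f" for c
  proof (rule antisym)
    show "sup_norm (fscale c f) \<le> norm c * sup_norm f"
      using norm_le_sup_norm[OF f] by (intro sup_norm_le) (auto simp: fscale_def norm_mult mult_left_mono)
    show "norm c * sup_norm f \<le> sup_norm (fscale c f)"
    proof (cases "c = 0")
      case True
      then show ?thesis
        by (simp add: fscale_def sup_norm_def)
    next
      case False
      have "sup_norm f \<le> sup_norm (fscale c f) / norm c"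
      proof (rule sup_norm_le)
        fix z :: complex assume "z \<in> unit_disk"
        then show "norm (f z) \<le> sup_norm (fscale c f) / norm c"
          using norm_le_sup_norm[OF scale[OF f], of z c] False
          by (simp add: fscale_def norm_mult field_simps)
      qed
      then show ?thesis
        using False by (simp add: field_simps)
    qed
  qed
qed

text \<open>Point evaluations are contractions for the supremum norm, and a Cauchy sequence
  converges uniformly, which preserves holomorphy and boundedness.\<close>

lemma banach_analytic_space_H_infty: "banach_analytic_space H_infty sup_norm"
proof -
  interpret H: normed_analytic_space H_infty sup_norm
    by (rule normed_analytic_space_H_infty)
  show ?thesis
  proof
    show "continuous_map H.mtopology euclidean (\<lambda>f. f z)" if z: "z \<in> unit_disk" for z
      unfolding continuous_map_def
    proof (intro conjI allI impI)
      fix U :: "complex set" assume "openin euclidean U"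
      then have U: "open U"
        by simp
      show "openin H.mtopology {f \<in> topspace H.mtopology. f z \<in> U}"
        unfolding H.openin_mtopology
      proof (intro conjI allI impI)
        fix f assume "f \<in> {f \<in> topspace H.mtopology. f z \<in> U}"
        then have f: "f \<in> H_infty" "f z \<in> U"
          by auto
        then obtain e where e: "0 < e" "ball (f z) e \<subseteq> U"
          using U open_contains_ball by blast
        have "g z \<in> U" if "g \<in> H_infty" "sup_norm (f - g) < e" for g
        proof -
          have "norm ((f - g) z) < e"
            using norm_le_sup_norm[OF H.diff_mem[OF f(1) that(1)] z] that(2) by linarith
          then show ?thesis
            using e by (auto simp: dist_norm)
        qed
        then show "\<exists>r>0. H.mball f r \<subseteq> {f \<in> topspace H.mtopology. f z \<in> U}"
          using e f by (intro exI[of _ e]) (auto simp: norm_dist_def)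
      qed auto
    qed auto
    show "H.mcomplete"
      unfolding H.mcomplete_def
    proof (intro allI impI)
      fix \<sigma> assume "H.MCauchy \<sigma>"
      then have \<sigma>: "\<And>n. \<sigma> n \<in> H_infty"
        and cauchy: "\<And>e. 0 < e \<Longrightarrow> \<exists>n0. \<forall>n n'. n0 \<le> n \<longrightarrow> n0 \<le> n' \<longrightarrow> sup_norm (\<sigma> n - \<sigma> n') < e"
        by (auto simp: H.MCauchy_def norm_dist_def image_subset_iff)
      \<comment> \<open>As all terms vanish off the disk, the estimate extends to the whole plane,
        and the limit satisfies the convention of extension by zero.\<close>
      have "uniformly_Cauchy_on UNIV \<sigma>"
        unfolding uniformly_Cauchy_on_def
      proof (intro allI impI)
        fix e :: real assume "e > 0"
        then obtain n0 where n0: "\<And>n n'. n0 \<le> n \<Longrightarrow> n0 \<le> n' \<Longrightarrow> sup_norm (\<sigma> n - \<sigma> n') < e"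
          using cauchy by blast
        have "dist (\<sigma> n z) (\<sigma> n' z) < e" if "n0 \<le> n" "n0 \<le> n'" for n n' z
        proof (cases "z \<in> unit_disk")
          case True
          then show ?thesis
            using n0[OF that] norm_le_sup_norm[OF H.diff_mem[OF \<sigma> \<sigma>] True, of n n'] by (simp add: dist_norm)
        next
          case False
          then show ?thesis
            using H_inftyD(2)[OF \<sigma>] \<open>e > 0\<close> by simp
        qed
        then show "\<exists>M. \<forall>x\<in>UNIV. \<forall>m\<ge>M. \<forall>n\<ge>M. dist (\<sigma> m x) (\<sigma> n x) < e"
          by blast
      qed
      then obtain l where l: "uniform_limit UNIV \<sigma> l sequentially"
        using Cauchy_uniformly_convergent uniformly_convergent_on_def by blast
      have l': "uniform_limit S \<sigma> l sequentially" for S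
        by (rule uniform_limit_on_subset[OF l]) auto
      obtain n0 where n0: "\<And>z. dist (\<sigma> n0 z) (l z) < 1"
        using uniform_limitD[OF l, of 1] by (auto simp: eventually_sequentially)
      have lH: "l \<in> H_infty"
      proof (rule H_inftyI)
        show "l holomorphic_on unit_disk"
        proof (rule holomorphic_uniform_sequence)
          show "\<exists>d>0. cball z d \<subseteq> unit_disk \<and> uniform_limit (cball z d) \<sigma> l sequentially" if "z \<in> unit_disk" for z
            using that l' open_contains_cball[of unit_disk] by blast
        qed (use H_inftyD(1)[OF \<sigma>] in auto)
        show "l z = 0" if "z \<notin> unit_disk" for z
          using tendsto_uniform_limitI[OF l, of z] H_inftyD(2)[OF \<sigma> that] by (simp add: LIMSEQ_const_iff)
        show "norm (l z) \<le> sup_norm (\<sigma> n0) + 1" if "z \<in> unit_disk" for z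
          using n0[of z] norm_le_sup_norm[OF \<sigma> that, of n0] norm_triangle_ineq2[of "l z" "\<sigma> n0 z"]
          by (simp add: dist_norm norm_minus_commute)
      qed
      have "limitin H.mtopology \<sigma> l sequentially"
        unfolding norm_topology_def[symmetric]
      proof (rule limitin_norm_topology[OF H.normed_analytic_space_axioms \<sigma> lH], rule tendstoI)
        fix e :: real assume "e > 0"
        then have "\<forall>\<^sub>F n in sequentially. \<forall>z\<in>UNIV. dist (\<sigma> n z) (l z) < e / 2"
          using uniform_limitD[OF l, of "e / 2"] by simp
        then show "\<forall>\<^sub>F n in sequentially. dist (sup_norm (\<sigma> n - l)) 0 < e"
        proof eventually_elim
          case (elim n)
          have "sup_norm (\<sigma> n - l) \<le> e / 2"
            using elim by (intro sup_norm_le) (auto simp: dist_norm less_imp_le)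
          then show ?case
            using H.norm_nonneg[OF H.diff_mem[OF \<sigma> lH]] \<open>e > 0\<close> by simp
        qed
      qed
      then show "\<exists>l. limitin H.mtopology \<sigma> l sequentially"
        by blast
    qed
  qed
qed

section \<open>Composition operators on polynomials\<close>

lemma poly_disk_in_H_infty: "disk_fun (poly q) \<in> H_infty"
proof -
  have "bounded (poly q ` cball 0 1)"
    by (intro compact_imp_bounded compact_continuous_image continuous_intros) auto
  then obtain B where "\<And>z. z \<in> cball 0 1 \<Longrightarrow> norm (poly q z) \<le> B"
    unfolding bounded_iff by blast
  moreover have "disk_fun (poly q) holomorphic_on unit_disk"
    by (rule holomorphic_transform[of "poly q"]) (auto simp: disk_fun_def intro!: holomorphic_intros)
  ultimately show ?thesis
    by (intro H_inftyI[where B = B]) (auto simp: disk_fun_def)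
qed

lemma comp_op_in_H_infty:
  assumes sg: "analytic_semigroup \<phi>" and f: "f \<in> H_infty" and "0 \<le> t"
  shows "comp_op \<phi> t f \<in> H_infty"
proof -
  have \<phi>: "\<phi> t holomorphic_on unit_disk" "\<phi> t ` unit_disk \<subseteq> unit_disk"
    using sg \<open>0 \<le> t\<close> by (auto simp: analytic_semigroup_def)
  show ?thesis
  proof (rule H_inftyI)
    have "f \<circ> \<phi> t holomorphic_on unit_disk"
      using \<phi> by (intro holomorphic_on_compose_gen[OF _ H_inftyD(1)[OF f]])
    then show "comp_op \<phi> t f holomorphic_on unit_disk"
      by (rule holomorphic_transform) (auto simp: comp_op_def disk_fun_def)
    show "norm (comp_op \<phi> t f z) \<le> sup_norm f" if "z \<in> unit_disk" for z
      using norm_le_sup_norm[OF f, of "\<phi> t z"] that \<phi>(2) by (auto simp: comp_op_def disk_fun_def image_subset_iff)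
  qed (auto simp: comp_op_def disk_fun_def)
qed

text \<open>A polynomial is uniformly continuous on the closed disk, so uniform convergence of
  \<open>\<phi> t\<close> to the identity on the whole open disk passes to the composition.\<close>

lemma tendsto_comp_op_poly:
  assumes sg: "analytic_semigroup \<phi>" and f: "f = disk_fun (poly q)"
  shows "((\<lambda>t. sup_norm (comp_op \<phi> t f - f)) \<longlongrightarrow> 0) (at_right 0)"
proof (rule tendstoI)
  interpret H: normed_analytic_space H_infty sup_norm
    by (rule normed_analytic_space_H_infty)
  fix e :: real assume "e > 0"
  have "uniformly_continuous_on (cball 0 1) (poly q)"
    by (intro compact_uniformly_continuous continuous_intros) auto
  then obtain d where d: "0 < d" "\<And>w z. w \<in> cball 0 1 \<Longrightarrow> z \<in> cball 0 1 \<Longrightarrow> dist w z < d \<Longrightarrow>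
      dist (poly q w) (poly q z) < e / 2"
    using \<open>e > 0\<close> unfolding uniformly_continuous_on_def by (metis half_gt_zero)
  obtain t0 where t0: "0 < t0" "\<And>t z. 0 \<le> t \<Longrightarrow> t < t0 \<Longrightarrow> z \<in> unit_disk \<Longrightarrow> norm (\<phi> t z - z) < d"
    using analytic_semigroup_tendsto_uniformly[OF sg d(1)] by blast
  have "dist (sup_norm (comp_op \<phi> t f - f)) 0 < e" if "0 < t" "t < t0" for t
  proof -
    have fH: "f \<in> H_infty"
      unfolding f by (rule poly_disk_in_H_infty)
    have "sup_norm (comp_op \<phi> t f - f) \<le> e / 2"
    proof (rule sup_norm_le)
      fix z assume z: "z \<in> unit_disk"
      have "\<phi> t z \<in> unit_disk"
        using sg that z unfolding analytic_semigroup_def by (meson image_subset_iff less_imp_le)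
      then show "norm ((comp_op \<phi> t f - f) z) \<le> e / 2"
        using d(2)[of "\<phi> t z" z] t0(2)[of t z] z that by (auto simp: f comp_op_def disk_fun_def dist_norm)
    qed
    moreover have "0 \<le> sup_norm (comp_op \<phi> t f - f)"
      using comp_op_in_H_infty[OF sg fH, of t] fH that by (intro H.norm_nonneg H.diff_mem) auto
    ultimately show ?thesis
      using \<open>e > 0\<close> by simp
  qed
  then show "\<forall>\<^sub>F t in at_right 0. dist (sup_norm (comp_op \<phi> t f - f)) 0 < e"
    unfolding eventually_at_right_field using t0(1) by blast
qed

section \<open>Lines as strongly continuous subspaces\<close>

text \<open>Norm limits are pointwise limits on the disk. Evaluation at a point where
  \<open>p\<close> does not vanish therefore makes the coefficients converge, and their limit is the
  coefficient of the limit function.\<close>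

lemma (in banach_analytic_space) closedin_line:
  assumes "p \<in> X"
  shows "closedin mtopology (range (\<lambda>c. fscale c p))"
  unfolding metric_closedin_iff_sequentially_closed
proof (intro conjI allI impI)
  show "range (\<lambda>c. fscale c p) \<subseteq> X"
    using assms scale_mem by auto
  fix \<sigma> l assume *: "range \<sigma> \<subseteq> range (\<lambda>c. fscale c p) \<and> limitin mtopology \<sigma> l sequentially"
  then have "\<forall>n. \<exists>c. \<sigma> n = fscale c p"
    by auto
  then obtain c where c: "\<And>n. \<sigma> n = fscale (c n) p"
    by metis
  have lX: "l \<in> X"
    using * limitin_mspace by blast
  have lim: "(\<lambda>n. c n * p z) \<longlonglongrightarrow> l z" if "z \<in> unit_disk" for z
    using tendsto_eval[OF conjunct2[OF *] that] by (simp add: c fscale_def)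
  have "\<exists>b. \<forall>z\<in>unit_disk. l z = b * p z"
  proof (cases "\<exists>z\<in>unit_disk. p z \<noteq> 0")
    case True
    then obtain w where w: "w \<in> unit_disk" "p w \<noteq> 0"
      by blast
    then have "(\<lambda>n. c n * p w / p w) \<longlonglongrightarrow> l w / p w"
      by (intro tendsto_divide lim tendsto_const)
    then have "c \<longlonglongrightarrow> l w / p w"
      using w by simp
    then have "l z = l w / p w * p z" if "z \<in> unit_disk" for z
      using LIMSEQ_unique[OF lim[OF that] tendsto_mult_right] by blast
    then show ?thesis
      by blast
  next
    case False
    then have "l z = 0 * p z" if "z \<in> unit_disk" for z
      using lim[OF that] that by (simp add: LIMSEQ_const_iff)
    then show ?thesis
      by blast
  qed
  then obtain b where b: "\<And>z. z \<in> unit_disk \<Longrightarrow> l z = b * p z"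
    by blast
  have "l = fscale b p"
  proof
    show "l z = fscale b p z" for z
      using b outside_disk[OF lX, of z] outside_disk[OF assms, of z]
      by (cases "z \<in> unit_disk") (auto simp: fscale_def)
  qed
  then show "l \<in> range (\<lambda>c. fscale c p)"
    by blast
qed

text \<open>Supplies competitors for the largest subspace: a line is closed and, by homogeneity,
  inherits strong continuity from its generator.\<close>

lemma strongly_continuous_line:
  assumes "banach_analytic_space X N" and acts: "acts_on \<phi> X N" and p: "p \<in> X"
    and lim: "((\<lambda>t. N (comp_op \<phi> t p - p)) \<longlongrightarrow> 0) (at_right 0)"
  shows "strongly_continuous_subspace \<phi> X N (range (\<lambda>c. fscale c p))"
  unfolding strongly_continuous_subspace_def
proof (intro conjI ballI)
  interpret banach_analytic_space X N
    by fact
  show "range (\<lambda>c. fscale c p) \<subseteq> X"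
    using p scale_mem by auto
  show "fun_space.subspace (range (\<lambda>c. fscale c p))"
    using fun_space.subspace_span[of "{p}"] by (simp add: fun_space.span_singleton)
  show "closedin (norm_topology X N) (range (\<lambda>c. fscale c p))"
    unfolding norm_topology_def by (rule closedin_line[OF p])
  fix f assume "f \<in> range (\<lambda>c. fscale c p)"
  then obtain c where f: "f = fscale c p"
    by blast
  have eq: "N (comp_op \<phi> t f - f) = norm c * N (comp_op \<phi> t p - p)" if "t > 0" for t
  proof -
    have "comp_op \<phi> t f - f = fscale c (comp_op \<phi> t p - p)"
      by (auto simp: f comp_op_def disk_fun_def fscale_def fun_eq_iff algebra_simps)
    moreover have "comp_op \<phi> t p \<in> X"
      using acts p that by (auto simp: acts_on_def)
    ultimately show ?thesis
      using p by (simp add: norm_scale diff_mem)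
  qed
  have "((\<lambda>t. norm c * N (comp_op \<phi> t p - p)) \<longlongrightarrow> 0) (at_right 0)"
    using tendsto_mult_left[OF lim, of "norm c"] by simp
  then show "((\<lambda>t. N (comp_op \<phi> t f - f)) \<longlongrightarrow> 0) (at_right 0)"
    by (rule Lim_transform_eventually) (auto simp: eq eventually_at_right_less intro: eventually_mono[OF eventually_at_right_less])
qed

theorem corollary1p3:
  fixes X :: "(complex \<Rightarrow> complex) set"
    and N :: "(complex \<Rightarrow> complex) \<Rightarrow> real"
    and \<phi> :: "real \<Rightarrow> complex \<Rightarrow> complex"
  assumes "banach_analytic_space X N"
    and "H_infty \<subseteq> X"
    and "analytic_semigroup \<phi>"
    and "acts_on \<phi> X N"
    and "has_max_subspace \<phi> X N"
  shows "poly_closure X N \<subseteq> max_subspace \<phi> X N"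
proof -
  interpret X: banach_analytic_space X N
    by fact
  interpret H: banach_analytic_space H_infty sup_norm
    by (rule banach_analytic_space_H_infty)
  obtain Y where Y: "strongly_continuous_subspace \<phi> X N Y"
    and max: "\<And>Z. strongly_continuous_subspace \<phi> X N Z \<Longrightarrow> Z \<subseteq> Y"
    using assms(5) by (auto simp: has_max_subspace_def)
  have Y_eq: "max_subspace \<phi> X N = Y"
    unfolding max_subspace_def using Y max by (rule Greatest_equality)
  obtain C where C: "\<And>f. f \<in> H_infty \<Longrightarrow> N f \<le> C * sup_norm f"
    using banach_analytic_space_inclusion_bounded[OF assms(1) banach_analytic_space_H_infty assms(2)] by blast
  have "p \<in> Y" if "p \<in> polynomials_disk" for p
  proof -
    obtain q where q: "p = disk_fun (poly q)"
      using \<open>p \<in> polynomials_disk\<close> by (auto simp: polynomials_disk_def)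
    then have pH: "p \<in> H_infty"
      using poly_disk_in_H_infty by simp
    have diffH: "comp_op \<phi> t p - p \<in> H_infty" if "t > 0" for t
      using comp_op_in_H_infty[OF assms(3) pH] pH that by (intro H.diff_mem) auto
    have pos: "\<forall>\<^sub>F t in at_right 0. 0 < (t :: real)"
      by (rule eventually_at_right_less)
    \<comment> \<open>The bounded inclusion of \<open>H_infty\<close> transfers the convergence from
      the supremum norm to \<open>N\<close>.\<close>
    have "((\<lambda>t. N (comp_op \<phi> t p - p)) \<longlongrightarrow> 0) (at_right 0)"
    proof (rule tendsto_sandwich[OF _ _ tendsto_const])
      show "\<forall>\<^sub>F t in at_right 0. 0 \<le> N (comp_op \<phi> t p - p)"
        using pos by eventually_elim (use diffH assms(2) X.norm_nonneg in blast)
      show "\<forall>\<^sub>F t in at_right 0. N (comp_op \<phi> t p - p) \<le> C * sup_norm (comp_op \<phi> t p - p)"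
        using pos by eventually_elim (use diffH C in blast)
      show "((\<lambda>t. C * sup_norm (comp_op \<phi> t p - p)) \<longlongrightarrow> 0) (at_right 0)"
        by (rule tendsto_mult_right_zero[OF tendsto_comp_op_poly[OF assms(3) q]])
    qed
    then have "range (\<lambda>c. fscale c p) \<subseteq> Y"
      using pH assms by (intro max strongly_continuous_line) auto
    moreover have "p = fscale 1 p"
      by (simp add: fscale_def)
    ultimately show ?thesis
      by blast
  qed
  \<comment> \<open>\<open>Y\<close> is closed, so containing the polynomials it contains their
    closure.\<close>
  then show ?thesis
    unfolding Y_eq poly_closure_def using Y
    by (intro closure_of_minimal) (auto simp: strongly_continuous_subspace_def)
qed

end
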